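(* Consider the scheme with topography $q_i^{n+1}=q_i^n-\frac{\Delta t}{\Delta x_i}\big(F_l(q_i^n,q_{i+1}^n,\Delta b_{i+1/2})-F_r(q_{i-1}^n,q_i^n,\Delta b_{i-1/2})\big)$, $\Delta b_{i+1/2}=b_{i+1}-b_i$, with the hydrostatically reconstructed fluxes described in the context. Then: (i) it is consistent with the system with topography of the context for smooth solutions; (ii) it keeps the positivity (nonnegativity) of $h,\sigma_{xx},\sigma_{zz}$ under the CFL condition $\Delta t\,A(q_l^\sharp,q_r^\sharp)\le\frac12\min(\Delta x_l,\Delta x_r)$ at every interface, where $q_l^\sharp,q_r^\sharp$ are the reconstructed states at that interface and $\Delta x_l,\Delta x_r$ the lengths of the adjacent cells; (iii) it is conservative in the variable $h$; (iv) it satisfies a semi-discrete energy inequality associated with $\partial_t\widetilde E+\partial_x\widetilde G\le0$: there exists a numerical energy flux $\widetilde{\mathcal G}(q_l,q_r,b_l,b_r)$ with $\widetilde{\mathcal G}(q,q,b,b)=\widetilde G(q,b)$ such that for all left/right data $\widetilde G(q_r,b_r)+\partial_q\widetilde E(q_r,b_r)\cdot\big(F_r(q_l,q_r,\Delta b)-F(q_r)\big)\le\widetilde{\mathcal G}(q_l,q_r,b_l,b_r)\le\widetilde G(q_l,b_l)+\partial_q\widetilde E(q_l,b_l)\cdot\big(F_l(q_l,q_r,\Delta b)-F(q_l)\big)$, where $\Delta b=b_r-b_l$ (these inequalities ensure that solutions of the semi-discrete scheme $\frac{d}{dt}q_i+\frac1{\Delta x_i}(F_l(q_i,q_{i+1},\Delta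 b_{i+1/2})-F_r(q_{i-1},q_i,\Delta b_{i-1/2}))=0$ satisfy $\frac{d}{dt}\widetilde E(q_i,b_i)+\frac1{\Delta x_i}(\widetilde{\mathcal G}_{i+1/2}-\widetilde{\mathcal G}_{i-1/2})\le0$); (v) it is well-balanced: it preserves the steady states at rest, i.e. if $u_i^n=0$, $h_i^n+b_i$ is independent of $i$ and $\sigma_{xx,i}^n=\sigma_{zz,i}^n=1$ for all $i$, then $q_i^{n+1}=q_i^n$ for all $i$.
   Context: System with topography $b(x)$ (given), constants $g,\eta_p,\lambda>0$: $\partial_th+\partial_x(hu)=0$, $\partial_t(hu)+\partial_x(hu^2+P)=-gh\partial_xb$, $\partial_t(h\sigma_{xx})+\partial_x(h\sigma_{xx}u)-2h\sigma_{xx}\partial_xu=0$, $\partial_t(h\sigma_{zz})+\partial_x(h\sigma_{zz}u)+2h\sigma_{zz}\partial_xu=0$, with $P=g\frac{h^2}{2}+\frac{\eta_p}{2\lambda}h(\sigma_{zz}-\sigma_{xx})$. State $q=(h,hu,h\sigma_{xx},h\sigma_{zz})$; $F(q)=(hu,\ hu^2+P,\ h\sigma_{xx}u,\ h\sigma_{zz}u)$. Energy $E(q)=h\frac{u^2}2+g\frac{h^2}{2}+\frac{\eta_p}{4\lambda}h(\sigma_{xx}+\sigma_{zz}-\ln(\sigma_{xx}\sigma_{zz})-2)$, $G(q)=(E+P)u$, $\widetilde E(q,b)=E(q)+ghb$, $\widetilde G(q,b)=G(q)+ghbu$; $\partial_q\widetilde E$ is the gradient of $\widetilde E$ with respect to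 $q$ at fixed $b$. Homogeneous solver (without topography): for states $q_l,q_r$, with $\partial_hP|_{\boldsymbol s}=gh+\frac{\eta_p}{2\lambda}(3\sigma_{zz}+\sigma_{xx})$, $P_{l,r}=P(q_{l,r})$, $a_{l,r}=\sqrt{\partial_hP|_{\boldsymbol s}(q_{l,r})}$, speeds $\frac{c_l}{h_l}=a_l+2\big(\max(0,u_l-u_r)+\frac{\max(0,P_r-P_l)}{h_la_l+h_ra_r}\big)$, $\frac{c_r}{h_r}=a_r+2\big(\max(0,u_l-u_r)+\frac{\max(0,P_l-P_r)}{h_la_l+h_ra_r}\big)$; $\pi_l=P_l,\pi_r=P_r$, $u^*=\frac{c_lu_l+c_ru_r+\pi_l-\pi_r}{c_l+c_r}$, $\pi^*=\frac{c_r\pi_l+c_l\pi_r-c_lc_r(u_r-u_l)}{c_l+c_r}$, $\frac1{h_l^*}=\frac1{h_l}+\frac{c_r(u_r-u_l)+\pi_l-\pi_r}{c_l(c_l+c_r)}$, $\frac1{h_r^*}=\frac1{h_r}+\frac{c_l(u_r-u_l)+\pi_r-\pi_l}{c_r(c_l+c_r)}$, $\sigma_{xx,l}^*=\sigma_{xx,l}(h_l/h_l^* )^2$, $\sigma_{xx,r}^*=\sigma_{xx,r}(h_r/h_r^* )^2$, $\sigma_{zz,l}^*=\sigma_{zz,l}(h_l^*/h_l)^2$, $\sigma_{zz,r}^*=\sigma_{zz,r}(h_r^*/h_r)^2$, $q_{l}^*=(h_l^*,h_l^*u^*,h_l^*\sigma^*_{xx,l},h_l^*\sigma^*_{zz,l})$,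 $q_r^*$ similarly; $\Sigma_1=u_l-c_l/h_l$, $\Sigma_2=u^*$, $\Sigma_3=u_r+c_r/h_r$; the self-similar solution equals $q_l$ ($\pi=\pi_l$) for $\xi<\Sigma_1$, $q_l^*$ ($\pi=\pi^*$) on $(\Sigma_1,\Sigma_2)$, $q_r^*$ ($\pi=\pi^*$) on $(\Sigma_2,\Sigma_3)$, $q_r$ ($\pi=\pi_r$) for $\xi>\Sigma_3$. Homogeneous fluxes $\mathcal F_l=(\mathcal F^h,\mathcal F^{hu},\mathcal F_l^{h\sigma_{xx}},\mathcal F_l^{h\sigma_{zz}})$, $\mathcal F_r=(\mathcal F^h,\mathcal F^{hu},\mathcal F_r^{h\sigma_{xx}},\mathcal F_r^{h\sigma_{zz}})$ with $\mathcal F^h=hu$, $\mathcal F^{hu}=hu^2+\pi$ evaluated at $\xi=0$, and for $w\in\{h\sigma_{xx},h\sigma_{zz}\}$: $\mathcal F_l^w=(wu)_l+\min(0,\Sigma_1)(w_l^*-w_l)+\min(0,\Sigma_2)(w_r^*-w_l^* )+\min(0,\Sigma_3)(w_r-w_r^* )$, $\mathcal F_r^w=(wu)_r-\max(0,\Sigma_1)(w_l^*-w_l)-\max(0,\Sigma_2)(w_r^*-w_l^* )-\max(0,\Sigma_3)(w_r-w_r^* )$. $A(q_l,q_r)=\max(|\Sigma_1|,|\Sigma_2|,|\Sigma_3|)$. The homogeneous solver is understood as extended to vacuum states ($h=0$) in the relaxation framework it comes from. Hydrostatic reconstruction: with $x_+=\max(0,x)$ and $\Delta b=b_r-b_l$,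 $h_l^\sharp=(h_l-(\Delta b)_+)_+$, $h_r^\sharp=(h_r-(-\Delta b)_+)_+$, $q_l^\sharp=(h_l^\sharp,h_l^\sharp u_l,h_l^\sharp\sigma_{xx,l},h_l^\sharp\sigma_{zz,l})$, $q_r^\sharp=(h_r^\sharp,h_r^\sharp u_r,h_r^\sharp\sigma_{xx,r},h_r^\sharp\sigma_{zz,r})$, and $F_l(q_l,q_r,\Delta b)=\mathcal F_l(q_l^\sharp,q_r^\sharp)+(0,\ g h_l^2/2-g(h_l^\sharp)^2/2,\ 0,\ 0)$, $F_r(q_l,q_r,\Delta b)=\mathcal F_r(q_l^\sharp,q_r^\sharp)+(0,\ gh_r^2/2-g(h_r^\sharp)^2/2,\ 0,\ 0)$. Mesh: cells of length $\Delta x_i$, cell values $b_i$ of the topography, time step $\Delta t$. *)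

theory Defs
  imports "HOL-Analysis.Analysis"
begin

text \<open>A state is q = (h, hu, h sigma_xx, h sigma_zz) in conservative variables.
  Primitive variables are obtained by division by h (with Isabelle's convention x/0 = 0,
  so that a vacuum state h = 0 has u = sigma_xx = sigma_zz = 0).
  The physical constants g, eta_p, lambda are explicit parameters g, eta, lam.\<close>

type_synonym st = "real \<times> real \<times> real \<times> real"

definition hh :: "st \<Rightarrow> real" where "hh q = fst q"
definition hu :: "st \<Rightarrow> real" where "hu q = fst (snd q)"
definition hsxx :: "st \<Rightarrow> real" where "hsxx q = fst (snd (snd q))"
definition hszz :: "st \<Rightarrow> real" where "hszz q = snd (snd (snd q))"

definition uu :: "st \<Rightarrow> real" where "uu q = hu q / hh q"
definition sxx :: "st \<Rightarrow> real" where "sxx q = hsxx q / hh q"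
definition szz :: "st \<Rightarrow> real" where "szz q = hszz q / hh q"

definition PP :: "real \<Rightarrow> real \<Rightarrow> real \<Rightarrow> st \<Rightarrow> real" where
  "PP g eta lam q = g * hh q ^ 2 / 2 + eta / (2 * lam) * hh q * (szz q - sxx q)"

definition flux :: "real \<Rightarrow> real \<Rightarrow> real \<Rightarrow> st \<Rightarrow> st" where
  "flux g eta lam q = (hu q, hu q * uu q + PP g eta lam q, hsxx q * uu q, hszz q * uu q)"

definition EE :: "real \<Rightarrow> real \<Rightarrow> real \<Rightarrow> st \<Rightarrow> real" where
  "EE g eta lam q = hh q * uu q ^ 2 / 2 + g * hh q ^ 2 / 2
     + eta / (4 * lam) * hh q * (sxx q + szz q - ln (sxx q * szz q) - 2)"

definition GG :: "real \<Rightarrow> real \<Rightarrow> real \<Rightarrow> st \<Rightarrow> real" where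
  "GG g eta lam q = (EE g eta lam q + PP g eta lam q) * uu q"

definition Et :: "real \<Rightarrow> real \<Rightarrow> real \<Rightarrow> st \<Rightarrow> real \<Rightarrow> real" where
  "Et g eta lam q b = EE g eta lam q + g * hh q * b"

definition Gt :: "real \<Rightarrow> real \<Rightarrow> real \<Rightarrow> st \<Rightarrow> real \<Rightarrow> real" where
  "Gt g eta lam q b = GG g eta lam q + g * hh q * b * uu q"

definition gradEt :: "real \<Rightarrow> real \<Rightarrow> real \<Rightarrow> st \<Rightarrow> real \<Rightarrow> st" where
  "gradEt g eta lam q b = (SOME D. GDERIV (\<lambda>q'. Et g eta lam q' b) q :> D)"

definition adm :: "st \<Rightarrow> bool" where
  "adm q \<longleftrightarrow> 0 < hh q \<and> 0 < sxx q \<and> 0 < szz q"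

definition dPdh :: "real \<Rightarrow> real \<Rightarrow> real \<Rightarrow> st \<Rightarrow> real" where
  "dPdh g eta lam q = g * hh q + eta / (2 * lam) * (3 * szz q + sxx q)"

definition aa :: "real \<Rightarrow> real \<Rightarrow> real \<Rightarrow> st \<Rightarrow> real" where
  "aa g eta lam q = sqrt (dPdh g eta lam q)"

definition cL :: "real \<Rightarrow> real \<Rightarrow> real \<Rightarrow> st \<Rightarrow> st \<Rightarrow> real" where
  "cL g eta lam ql qr = hh ql * (aa g eta lam ql + 2 * (max 0 (uu ql - uu qr)
      + max 0 (PP g eta lam qr - PP g eta lam ql)
          / (hh ql * aa g eta lam ql + hh qr * aa g eta lam qr)))"

definition cR :: "real \<Rightarrow> real \<Rightarrow> real \<Rightarrow> st \<Rightarrow> st \<Rightarrow> real" where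
  "cR g eta lam ql qr = hh qr * (aa g eta lam qr + 2 * (max 0 (uu ql - uu qr)
      + max 0 (PP g eta lam ql - PP g eta lam qr)
          / (hh ql * aa g eta lam ql + hh qr * aa g eta lam qr)))"

definition ustar :: "real \<Rightarrow> real \<Rightarrow> real \<Rightarrow> st \<Rightarrow> st \<Rightarrow> real" where
  "ustar g eta lam ql qr =
     (cL g eta lam ql qr * uu ql + cR g eta lam ql qr * uu qr + PP g eta lam ql - PP g eta lam qr)
     / (cL g eta lam ql qr + cR g eta lam ql qr)"

definition pistar :: "real \<Rightarrow> real \<Rightarrow> real \<Rightarrow> st \<Rightarrow> st \<Rightarrow> real" where
  "pistar g eta lam ql qr =
     (cR g eta lam ql qr * PP g eta lam ql + cL g eta lam ql qr * PP g eta lam qr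
       - cL g eta lam ql qr * cR g eta lam ql qr * (uu qr - uu ql))
     / (cL g eta lam ql qr + cR g eta lam ql qr)"

definition hLstar :: "real \<Rightarrow> real \<Rightarrow> real \<Rightarrow> st \<Rightarrow> st \<Rightarrow> real" where
  "hLstar g eta lam ql qr = (if hh ql = 0 then 0 else
     1 / (1 / hh ql + (cR g eta lam ql qr * (uu qr - uu ql) + PP g eta lam ql - PP g eta lam qr)
           / (cL g eta lam ql qr * (cL g eta lam ql qr + cR g eta lam ql qr))))"

definition hRstar :: "real \<Rightarrow> real \<Rightarrow> real \<Rightarrow> st \<Rightarrow> st \<Rightarrow> real" where
  "hRstar g eta lam ql qr = (if hh qr = 0 then 0 else
     1 / (1 / hh qr + (cL g eta lam ql qr * (uu qr - uu ql) + PP g eta lam qr - PP g eta lam ql)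
           / (cR g eta lam ql qr * (cL g eta lam ql qr + cR g eta lam ql qr))))"

definition qLstar :: "real \<Rightarrow> real \<Rightarrow> real \<Rightarrow> st \<Rightarrow> st \<Rightarrow> st" where
  "qLstar g eta lam ql qr = (let hs = hLstar g eta lam ql qr in
     (hs, hs * ustar g eta lam ql qr,
      hs * (sxx ql * (hh ql / hs) ^ 2), hs * (szz ql * (hs / hh ql) ^ 2)))"

definition qRstar :: "real \<Rightarrow> real \<Rightarrow> real \<Rightarrow> st \<Rightarrow> st \<Rightarrow> st" where
  "qRstar g eta lam ql qr = (let hs = hRstar g eta lam ql qr in
     (hs, hs * ustar g eta lam ql qr,
      hs * (sxx qr * (hh qr / hs) ^ 2), hs * (szz qr * (hs / hh qr) ^ 2)))"

text \<open>Wave speeds; at a vacuum side the outer wave merges with the contact (speed u*).\<close>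
definition Sig1 :: "real \<Rightarrow> real \<Rightarrow> real \<Rightarrow> st \<Rightarrow> st \<Rightarrow> real" where
  "Sig1 g eta lam ql qr = (if hh ql = 0 then ustar g eta lam ql qr
     else uu ql - cL g eta lam ql qr / hh ql)"

definition Sig2 :: "real \<Rightarrow> real \<Rightarrow> real \<Rightarrow> st \<Rightarrow> st \<Rightarrow> real" where
  "Sig2 g eta lam ql qr = ustar g eta lam ql qr"

definition Sig3 :: "real \<Rightarrow> real \<Rightarrow> real \<Rightarrow> st \<Rightarrow> st \<Rightarrow> real" where
  "Sig3 g eta lam ql qr = (if hh qr = 0 then ustar g eta lam ql qr
     else uu qr + cR g eta lam ql qr / hh qr)"

definition Amax :: "real \<Rightarrow> real \<Rightarrow> real \<Rightarrow> st \<Rightarrow> st \<Rightarrow> real" where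
  "Amax g eta lam ql qr = max \<bar>Sig1 g eta lam ql qr\<bar> (max \<bar>Sig2 g eta lam ql qr\<bar> \<bar>Sig3 g eta lam ql qr\<bar>)"

text \<open>State and relaxation pressure pi of the self-similar solution at xi = 0.\<close>
definition stateAt0 :: "real \<Rightarrow> real \<Rightarrow> real \<Rightarrow> st \<Rightarrow> st \<Rightarrow> st \<times> real" where
  "stateAt0 g eta lam ql qr =
     (if 0 < Sig1 g eta lam ql qr then (ql, PP g eta lam ql)
      else if 0 < Sig2 g eta lam ql qr then (qLstar g eta lam ql qr, pistar g eta lam ql qr)
      else if 0 < Sig3 g eta lam ql qr then (qRstar g eta lam ql qr, pistar g eta lam ql qr)
      else (qr, PP g eta lam qr))"

definition Fh_hom :: "real \<Rightarrow> real \<Rightarrow> real \<Rightarrow> st \<Rightarrow> st \<Rightarrow> real" where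
  "Fh_hom g eta lam ql qr = hu (fst (stateAt0 g eta lam ql qr))"

definition Fhu_hom :: "real \<Rightarrow> real \<Rightarrow> real \<Rightarrow> st \<Rightarrow> st \<Rightarrow> real" where
  "Fhu_hom g eta lam ql qr = (let (q0, pi0) = stateAt0 g eta lam ql qr in hu q0 * uu q0 + pi0)"

definition FwL :: "real \<Rightarrow> real \<Rightarrow> real \<Rightarrow> (st \<Rightarrow> real) \<Rightarrow> st \<Rightarrow> st \<Rightarrow> real" where
  "FwL g eta lam W ql qr =
     W ql * uu ql
     + min 0 (Sig1 g eta lam ql qr) * (W (qLstar g eta lam ql qr) - W ql)
     + min 0 (Sig2 g eta lam ql qr) * (W (qRstar g eta lam ql qr) - W (qLstar g eta lam ql qr))
     + min 0 (Sig3 g eta lam ql qr) * (W qr - W (qRstar g eta lam ql qr))"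

definition FwR :: "real \<Rightarrow> real \<Rightarrow> real \<Rightarrow> (st \<Rightarrow> real) \<Rightarrow> st \<Rightarrow> st \<Rightarrow> real" where
  "FwR g eta lam W ql qr =
     W qr * uu qr
     - max 0 (Sig1 g eta lam ql qr) * (W (qLstar g eta lam ql qr) - W ql)
     - max 0 (Sig2 g eta lam ql qr) * (W (qRstar g eta lam ql qr) - W (qLstar g eta lam ql qr))
     - max 0 (Sig3 g eta lam ql qr) * (W qr - W (qRstar g eta lam ql qr))"

definition FL_hom :: "real \<Rightarrow> real \<Rightarrow> real \<Rightarrow> st \<Rightarrow> st \<Rightarrow> st" where
  "FL_hom g eta lam ql qr = (Fh_hom g eta lam ql qr, Fhu_hom g eta lam ql qr,
      FwL g eta lam hsxx ql qr, FwL g eta lam hszz ql qr)"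

definition FR_hom :: "real \<Rightarrow> real \<Rightarrow> real \<Rightarrow> st \<Rightarrow> st \<Rightarrow> st" where
  "FR_hom g eta lam ql qr = (Fh_hom g eta lam ql qr, Fhu_hom g eta lam ql qr,
      FwR g eta lam hsxx ql qr, FwR g eta lam hszz ql qr)"

definition hsharpL :: "st \<Rightarrow> real \<Rightarrow> real" where
  "hsharpL ql db = max 0 (hh ql - max 0 db)"

definition hsharpR :: "st \<Rightarrow> real \<Rightarrow> real" where
  "hsharpR qr db = max 0 (hh qr - max 0 (- db))"

definition recon :: "st \<Rightarrow> real \<Rightarrow> st" where
  "recon q hs = (hs, hs * uu q, hs * sxx q, hs * szz q)"

definition qsharpL :: "st \<Rightarrow> real \<Rightarrow> st" where
  "qsharpL ql db = recon ql (hsharpL ql db)"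

definition qsharpR :: "st \<Rightarrow> real \<Rightarrow> st" where
  "qsharpR qr db = recon qr (hsharpR qr db)"

definition FL :: "real \<Rightarrow> real \<Rightarrow> real \<Rightarrow> st \<Rightarrow> st \<Rightarrow> real \<Rightarrow> st" where
  "FL g eta lam ql qr db = FL_hom g eta lam (qsharpL ql db) (qsharpR qr db)
     + (0, g * hh ql ^ 2 / 2 - g * (hsharpL ql db) ^ 2 / 2, 0, 0)"

definition FR :: "real \<Rightarrow> real \<Rightarrow> real \<Rightarrow> st \<Rightarrow> st \<Rightarrow> real \<Rightarrow> st" where
  "FR g eta lam ql qr db = FR_hom g eta lam (qsharpL ql db) (qsharpR qr db)
     + (0, g * hh qr ^ 2 / 2 - g * (hsharpR qr db) ^ 2 / 2, 0, 0)"

definition scheme_step :: "real \<Rightarrow> real \<Rightarrow> real \<Rightarrow> real \<Rightarrow> (int \<Rightarrow> real) \<Rightarrow> (int \<Rightarrow> real)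
    \<Rightarrow> (int \<Rightarrow> st) \<Rightarrow> int \<Rightarrow> st" where
  "scheme_step g eta lam dt dx b q i = q i - (dt / dx i) *\<^sub>R
     (FL g eta lam (q i) (q (i + 1)) (b (i + 1) - b i)
      - FR g eta lam (q (i - 1)) (q i) (b i - b (i - 1)))"

text \<open>The system reads dq/dt + d/dx F(q) + N(q)(dq/dx, db/dx) = 0 with the nonconservative
  part N(q)(dq, db) = (0, g h db, -2 h sigma_xx du, 2 h sigma_zz du), du = (d(hu) - u dh)/h.\<close>
definition ncterm :: "real \<Rightarrow> st \<Rightarrow> st \<Rightarrow> real \<Rightarrow> st" where
  "ncterm g q dq db = (let du = (hu dq - uu q * hh dq) / hh q in
     (0, g * hh q * db, - 2 * hsxx q * du, 2 * hszz q * du))"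

definition consistent_fluxes ::
  "real \<Rightarrow> real \<Rightarrow> real \<Rightarrow> (st \<Rightarrow> st \<Rightarrow> real \<Rightarrow> st) \<Rightarrow> (st \<Rightarrow> st \<Rightarrow> real \<Rightarrow> st) \<Rightarrow> bool" where
  "consistent_fluxes g eta lam FLf FRf \<longleftrightarrow>
     (\<forall>q. adm q \<longrightarrow> FLf q q 0 = flux g eta lam q \<and> FRf q q 0 = flux g eta lam q) \<and>
     (\<forall>q. adm q \<longrightarrow> (\<forall>e>0. \<exists>d>0. \<forall>ql qr db.
        norm (ql - q) < d \<and> norm (qr - q) < d \<and> \<bar>db\<bar> < d \<longrightarrow>
        norm (FRf ql qr db - FLf ql qr db + ncterm g q (qr - ql) db)
          \<le> e * (norm (qr - ql) + \<bar>db\<bar>)))"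

end

theory Submission
  imports Defs "HOL-Library.Landau_Symbols"
begin

text \<open>The reconstructed interface states are solved by the relaxation Riemann solver, whose waves
  satisfy the Rankine-Hugoniot relations \<open>h\<^sub>l (u\<^sub>l - \<Sigma>\<^sub>1) = h\<^sub>l\<^sup>* (u\<^sup>* - \<Sigma>\<^sub>1) = c\<^sub>l\<close> and
  \<open>c\<^sub>l (u\<^sup>* - u\<^sub>l) = \<pi>\<^sub>l - \<pi>\<^sup>*\<close>. Hence every numerical flux is the flux at the left state plus
  \<open>min 0 \<Sigma>\<^sub>j\<close> times the jump across the \<open>j\<close>-th wave. The choice of \<open>c\<^sub>l\<close> gives
  \<open>h\<^sub>l / h\<^sub>l\<^sup>* \<ge> (a\<^sub>l + X) / (a\<^sub>l + 2 X)\<close> with \<open>c\<^sub>l = h\<^sub>l (a\<^sub>l + 2 X)\<close>, which yields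
  positivity and the subcharacteristic condition \<open>(h\<^sub>l\<^sup>* / h\<^sub>l)\<^sup>2 a\<^sub>l \<le> c\<^sub>l / h\<^sub>l\<close>. Under the latter the energy
  carried by the relaxation solution dominates the energy of its states. Convexity of the energy and
  summation by parts over the waves then give the energy inequality for the
  homogeneous solver. The hydrostatic terms only add \<open>g (h\<^sub>l + b\<^sub>l - h\<^sub>l\<^sup>#) F\<^sup>h\<close>, where
  \<open>h\<^sub>l + b\<^sub>l - h\<^sub>l\<^sup># \<le> max b\<^sub>l b\<^sub>r\<close> with equality unless \<open>h\<^sub>l\<^sup># = 0\<close>, in which case \<open>F\<^sup>h \<le> 0\<close>.\<close>
lemmas st_defs = hh_def hu_def hsxx_def hszz_def

section \<open>The relaxation Riemann solver\<close>

definition wet :: "st \<Rightarrow> bool" where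
  "wet q \<longleftrightarrow> q = 0 \<or> (0 < hh q \<and> 0 \<le> sxx q \<and> 0 \<le> szz q)"

text \<open>Reflection \<open>x \<mapsto> -x\<close>: applied to both states and with the sides exchanged, it turns every
  statement about the left wave into the one about the right wave.\<close>

definition mir :: "st \<Rightarrow> st" where
  "mir q = (hh q, - hu q, hsxx q, hszz q)"

lemma mir_simps [simp]:
  "hh (mir q) = hh q" "hu (mir q) = - hu q" "hsxx (mir q) = hsxx q" "hszz (mir q) = hszz q"
  "uu (mir q) = - uu q" "sxx (mir q) = sxx q" "szz (mir q) = szz q" "mir (mir q) = q"
  "PP g eta lam (mir q) = PP g eta lam q" "aa g eta lam (mir q) = aa g eta lam q"
  "EE g eta lam (mir q) = EE g eta lam q" "GG g eta lam (mir q) = - GG g eta lam q"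
  by (auto simp: mir_def st_defs uu_def sxx_def szz_def PP_def aa_def dPdh_def EE_def GG_def)

lemma st_zero [simp]:
  "hh 0 = 0" "hu 0 = 0" "hsxx 0 = 0" "hszz 0 = 0" "uu 0 = 0" "sxx 0 = 0" "szz 0 = 0"
  "PP g eta lam 0 = 0" "EE g eta lam 0 = 0" "GG g eta lam 0 = 0" "flux g eta lam 0 = 0" "mir 0 = 0"
  by (auto simp: mir_def st_defs uu_def sxx_def szz_def PP_def EE_def GG_def flux_def zero_prod_def)

lemma st_linear:
  "hh (v + w) = hh v + hh w" "hh (v - w) = hh v - hh w" "hh (r *\<^sub>R v) = r * hh v"
  "hu (v + w) = hu v + hu w" "hu (v - w) = hu v - hu w" "hu (r *\<^sub>R v) = r * hu v"
  "hsxx (v + w) = hsxx v + hsxx w" "hsxx (v - w) = hsxx v - hsxx w" "hsxx (r *\<^sub>R v) = r * hsxx v"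
  "hszz (v + w) = hszz v + hszz w" "hszz (v - w) = hszz v - hszz w" "hszz (r *\<^sub>R v) = r * hszz v"
  by (simp_all add: st_defs)

lemma inner_st: "v \<bullet> (a, b, c, d) = a * hh v + b * hu v + c * hsxx v + d * hszz v"
  by (simp add: inner_prod_def st_defs)

lemma wet_mir: "wet q \<Longrightarrow> wet (mir q)"
  by (auto simp: wet_def)

lemma wet_zero: "wet q \<Longrightarrow> hh q = 0 \<Longrightarrow> q = 0"
  by (auto simp: wet_def)

lemma mir_star:
  "cL g eta lam (mir qr) (mir ql) = cR g eta lam ql qr"
  "cR g eta lam (mir qr) (mir ql) = cL g eta lam ql qr"
  "ustar g eta lam (mir qr) (mir ql) = - ustar g eta lam ql qr"
  "pistar g eta lam (mir qr) (mir ql) = pistar g eta lam ql qr"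
  "hLstar g eta lam (mir qr) (mir ql) = hRstar g eta lam ql qr"
  "hRstar g eta lam (mir qr) (mir ql) = hLstar g eta lam ql qr"
  "Sig1 g eta lam (mir qr) (mir ql) = - Sig3 g eta lam ql qr"
  "Sig3 g eta lam (mir qr) (mir ql) = - Sig1 g eta lam ql qr"
proof -
  show c: "cL g eta lam (mir qr) (mir ql) = cR g eta lam ql qr"
     "cR g eta lam (mir qr) (mir ql) = cL g eta lam ql qr"
    by (auto simp: cL_def cR_def add.commute)
  show u: "ustar g eta lam (mir qr) (mir ql) = - ustar g eta lam ql qr"
    by (simp add: ustar_def c add.commute flip: minus_divide_left)
       (simp add: minus_divide_left algebra_simps)
  show "pistar g eta lam (mir qr) (mir ql) = pistar g eta lam ql qr"
    by (simp add: pistar_def c algebra_simps)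
  show "hLstar g eta lam (mir qr) (mir ql) = hRstar g eta lam ql qr"
    by (simp add: hLstar_def hRstar_def c algebra_simps)
  show "hRstar g eta lam (mir qr) (mir ql) = hLstar g eta lam ql qr"
    by (simp add: hLstar_def hRstar_def c algebra_simps)
  show "Sig1 g eta lam (mir qr) (mir ql) = - Sig3 g eta lam ql qr"
    "Sig3 g eta lam (mir qr) (mir ql) = - Sig1 g eta lam ql qr"
    by (auto simp: Sig1_def Sig3_def c u)
qed

lemma qLstar_sel:
  "hh (qLstar g eta lam ql qr) = hLstar g eta lam ql qr"
  "hu (qLstar g eta lam ql qr) = hLstar g eta lam ql qr * ustar g eta lam ql qr"
  "hsxx (qLstar g eta lam ql qr) = hLstar g eta lam ql qr * (sxx ql * (hh ql / hLstar g eta lam ql qr) ^ 2)"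
  "hszz (qLstar g eta lam ql qr) = hLstar g eta lam ql qr * (szz ql * (hLstar g eta lam ql qr / hh ql) ^ 2)"
  by (auto simp: qLstar_def Let_def st_defs)

lemma qLstar_mir: "qLstar g eta lam (mir qr) (mir ql) = mir (qRstar g eta lam ql qr)"
  by (simp add: qLstar_def qRstar_def mir_star Let_def) (simp add: mir_def st_defs)

text \<open>Energy of the star states in the relaxation system: the specific internal energy \<open>e\<close> is advanced
  by keeping \<open>e - \<pi>\<^sup>2 / (2 c\<^sup>2)\<close> constant across the outer wave.\<close>

definition EhatL :: "real \<Rightarrow> real \<Rightarrow> real \<Rightarrow> st \<Rightarrow> st \<Rightarrow> real" where
  "EhatL g eta lam ql qr = hLstar g eta lam ql qr *
     ((ustar g eta lam ql qr)^2 / 2 + EE g eta lam ql / hh ql - (uu ql)^2 / 2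
       + ((pistar g eta lam ql qr)^2 - (PP g eta lam ql)^2) / (2 * (cL g eta lam ql qr)^2))"

definition EhatR :: "real \<Rightarrow> real \<Rightarrow> real \<Rightarrow> st \<Rightarrow> st \<Rightarrow> real" where
  "EhatR g eta lam ql qr = EhatL g eta lam (mir qr) (mir ql)"

locale viscoelastic =
  fixes g eta lam :: real
  assumes g_pos: "0 < g" and eta_pos: "0 < eta" and lam_pos: "0 < lam"
begin

definition "k = eta / (4 * lam)"

lemma k_pos: "0 < k"
  using eta_pos lam_pos by (simp add: k_def)

lemma k_fold: "eta / (4 * lam) = k" "eta / (2 * lam) = 2 * k"
  by (simp_all add: k_def)

lemma aa_sq: "wet q \<Longrightarrow> (aa g eta lam q)^2 = g * hh q + 2 * k * (3 * szz q + sxx q)"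
  and aa_pos: "wet q \<Longrightarrow> 0 < hh q \<Longrightarrow> 0 < aa g eta lam q"
  and aa_nonneg: "wet q \<Longrightarrow> 0 \<le> aa g eta lam q"
proof -
  assume w: "wet q"
  have n: "0 \<le> 2 * k * (3 * szz q + sxx q)" "0 \<le> g * hh q"
    using w k_pos g_pos by (auto simp: wet_def intro!: mult_nonneg_nonneg)
  then show "(aa g eta lam q)^2 = g * hh q + 2 * k * (3 * szz q + sxx q)" "0 \<le> aa g eta lam q"
    unfolding aa_def dPdh_def k_fold by auto
  assume "0 < hh q"
  then have "0 < g * hh q" using g_pos by simp
  then show "0 < aa g eta lam q" using n unfolding aa_def dPdh_def k_fold by auto
qed

end

section \<open>Star states: positivity, wave ordering and speed bounds\<close>

locale riemann = viscoelastic +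
  fixes ql qr :: st
  assumes wet_l: "wet ql" and wet_r: "wet qr"
begin

abbreviation "hl \<equiv> hh ql"
abbreviation "hr \<equiv> hh qr"
abbreviation "ul \<equiv> uu ql"
abbreviation "ur \<equiv> uu qr"
abbreviation "al \<equiv> aa g eta lam ql"
abbreviation "ar \<equiv> aa g eta lam qr"
abbreviation "Pl \<equiv> PP g eta lam ql"
abbreviation "Pr \<equiv> PP g eta lam qr"
abbreviation "cl \<equiv> cL g eta lam ql qr"
abbreviation "cr \<equiv> cR g eta lam ql qr"
abbreviation "us \<equiv> ustar g eta lam ql qr"
abbreviation "ps \<equiv> pistar g eta lam ql qr"
abbreviation "hls \<equiv> hLstar g eta lam ql qr"
abbreviation "hrs \<equiv> hRstar g eta lam ql qr"
abbreviation "S1 \<equiv> Sig1 g eta lam ql qr"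
abbreviation "S2 \<equiv> Sig2 g eta lam ql qr"
abbreviation "S3 \<equiv> Sig3 g eta lam ql qr"
abbreviation "qls \<equiv> qLstar g eta lam ql qr"
abbreviation "qrs \<equiv> qRstar g eta lam ql qr"

text \<open>The quantity \<open>X\<close> of the overview. It dominates the velocity drop
  \<open>ul - us\<close> across the left wave and enters \<open>cl\<close> with the factor
  2.\<close>

definition "XL = max 0 (ul - ur) + max 0 (Pr - Pl) / (hl * al + hr * ar)"

text \<open>Source of the right-wave estimates: instantiating the setting at the reflected data and
  rewriting with \<open>mir_star\<close> turns a left statement into its right counterpart.\<close>

lemma riemann_mir: "riemann g eta lam (mir qr) (mir ql)"
  using wet_l wet_r by unfold_locales (auto intro: wet_mir)

lemma h_nonneg: "0 \<le> hl" "0 \<le> hr"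
  using wet_l wet_r by (auto simp: wet_def)

lemma XL_nonneg: "0 \<le> XL"
  unfolding XL_def using h_nonneg aa_nonneg wet_l wet_r
  by (intro add_nonneg_nonneg divide_nonneg_nonneg mult_nonneg_nonneg) auto

lemma cl_eq: "cl = hl * (al + 2 * XL)"
  by (simp add: cL_def XL_def)

lemma cl_ge: "hl * al \<le> cl"
  unfolding cl_eq using h_nonneg XL_nonneg by (intro mult_left_mono) auto

lemma cl_nonneg: "0 \<le> cl"
  using cl_ge h_nonneg aa_nonneg[OF wet_l] by (meson mult_nonneg_nonneg order_trans)

lemma cl_pos: "0 < hl \<Longrightarrow> 0 < cl"
  using cl_ge aa_pos[OF wet_l] by (metis mult_pos_pos less_le_trans)

text \<open>An empty left side has a zero star state and its outer wave merges with the contact, so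
  the wave relations below hold trivially in that case.\<close>

lemma left_vacuum: "hl = 0 \<Longrightarrow> ql = 0 \<and> cl = 0 \<and> hls = 0 \<and> qls = 0 \<and> S1 = us \<and> S1 = S2"
proof -
  assume "hl = 0"
  then have "ql = 0" "cl = 0" "hls = 0" using wet_zero[OF wet_l] by (simp_all add: cL_def hLstar_def)
  then show ?thesis by (simp add: qLstar_def Sig1_def Sig2_def flip: zero_prod_def)
qed

end

context riemann begin

interpretation m: riemann g eta lam "mir qr" "mir ql" by (rule riemann_mir)

lemma cr_ge: "hr * ar \<le> cr"
  and cr_nonneg: "0 \<le> cr"
  and cr_pos: "0 < hr \<Longrightarrow> 0 < cr"
  and right_vacuum: "hr = 0 \<Longrightarrow> qr = 0 \<and> cr = 0 \<and> hrs = 0 \<and> qrs = 0 \<and> S3 = us \<and> S3 = S2"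
proof -
  show "hr * ar \<le> cr" "0 \<le> cr" "0 < hr \<Longrightarrow> 0 < cr"
    using m.cl_ge m.cl_nonneg m.cl_pos by (simp_all add: mir_star)
  assume "hr = 0"
  then have "qr = 0" "cr = 0" "hrs = 0" using wet_zero[OF wet_r] by (auto simp: cR_def hRstar_def)
  then show "qr = 0 \<and> cr = 0 \<and> hrs = 0 \<and> qrs = 0 \<and> S3 = us \<and> S3 = S2"
    by (simp add: qRstar_def Sig3_def Sig2_def flip: zero_prod_def)
qed

lemma us_minus_ul: "0 < hl \<Longrightarrow> us - ul = (cr * (ur - ul) + Pl - Pr) / (cl + cr)"
  using cl_pos cr_nonneg by (simp add: ustar_def field_simps)

lemma cl_jump: "cl * (us - ul) = Pl - ps"
proof (cases "hl = 0")
  case True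
  then have *: "ql = 0" "cl = 0" using left_vacuum by auto
  \<comment> \<open>All terms in the numerator of \<open>ps\<close> vanish. If the right side is
    empty too, the quotient is 0/0, which is 0 by convention.\<close>
  show ?thesis
    by (cases "hr = 0") (use * cr_pos h_nonneg in \<open>auto simp: pistar_def\<close>)
next
  case False
  then have "0 < cl + cr" using h_nonneg cl_pos cr_nonneg by fastforce
  then show ?thesis by (simp add: ustar_def pistar_def field_simps)
qed

text \<open>The drop \<open>ul - us\<close> is a fraction of \<open>ul - ur\<close> plus a pressure
  difference over \<open>cl + cr\<close>, and \<open>cl + cr\<close> is at least
  \<open>hl * al + hr * ar\<close>; hence it is at most \<open>XL\<close>. Relative to
  \<open>cl / hl = al + 2 * XL\<close> this removes less than one half, so the ratio stays positive,
  and so does \<open>hls\<close>.\<close>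

lemma left_ratio:
  assumes "0 < hl"
  shows "0 < hls" "hl / hls = 1 + hl * (us - ul) / cl"
    "(al + XL) / (al + 2 * XL) \<le> hl / hls"
proof -
  have c: "0 < cl" "0 < cl + cr" using cl_pos cr_nonneg assms by fastforce+
  have a: "0 < al" using aa_pos[OF wet_l] assms .
  have inv: "1 / hls = 1 / hl + (us - ul) / cl"
    using assms us_minus_ul[OF assms] by (simp add: hLstar_def)
  have D: "0 < hl * al + hr * ar" "hl * al + hr * ar \<le> cl + cr"
    using cl_ge cr_ge h_nonneg assms a aa_nonneg[OF wet_r]
    by (auto intro!: add_pos_nonneg mult_pos_pos)
  have "- (us - ul) = cr / (cl + cr) * (ul - ur) + (Pr - Pl) / (cl + cr)"
    by (simp add: us_minus_ul[OF assms] add_divide_distrib diff_divide_distrib algebra_simps)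
  also have "cr / (cl + cr) * (ul - ur) \<le> 1 * max 0 (ul - ur)"
    using c cr_nonneg by (intro order_trans[OF mult_left_mono[of "ul - ur" "max 0 (ul - ur)"] mult_right_mono]) auto
  also have "(Pr - Pl) / (cl + cr) \<le> max 0 (Pr - Pl) / (hl * al + hr * ar)"
    using c D by (intro frac_le) auto
  finally have X: "- (us - ul) \<le> XL" by (simp add: XL_def)
  have ineq: "(al + XL) / (al + 2 * XL) \<le> 1 + hl * (us - ul) / cl"
  proof -
    have B: "0 < al + 2 * XL" using a XL_nonneg by simp
    have "hl * (us - ul) / cl = (us - ul) / (al + 2 * XL)" using assms by (simp add: cl_eq)
    moreover have "(al + XL) / (al + 2 * XL) = 1 + (- XL) / (al + 2 * XL)" using B by (simp add: field_simps)
    moreover have "(- XL) / (al + 2 * XL) \<le> (us - ul) / (al + 2 * XL)"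
      using X B by (intro divide_right_mono) auto
    ultimately show ?thesis by linarith
  qed
  have r: "hl / hls = 1 + hl * (us - ul) / cl"
  proof -
    have "hl * (1 / hls) = hl * (1 / hl + (us - ul) / cl)" using inv by simp
    then show ?thesis using assms by (simp add: distrib_left)
  qed
  show "hl / hls = 1 + hl * (us - ul) / cl" by fact
  show "(al + XL) / (al + 2 * XL) \<le> hl / hls" using ineq r by simp
  moreover have "0 < (al + XL) / (al + 2 * XL)" using a XL_nonneg by simp
  ultimately have "0 < hl / hls" by linarith
  then show "0 < hls" using assms by (simp add: zero_less_divide_iff)
qed

lemma left_mass: "hl * (ul - S1) = cl" "hls * (us - S1) = cl"
proof -
  show "hl * (ul - S1) = cl"
    using left_vacuum by (cases "hl = 0") (auto simp: Sig1_def)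
  show "hls * (us - S1) = cl"
  proof (cases "hl = 0")
    case False
    then have h: "0 < hl" using h_nonneg by simp
    have "(hl / hls) * hls = hls * (1 + hl * (us - ul) / cl)" using left_ratio[OF h] by simp
    then have "hl = hls + hls * hl * (us - ul) / cl" using left_ratio(1)[OF h] by (simp add: algebra_simps)
    then have "hl * cl = hls * cl + hls * hl * (us - ul)" using cl_pos[OF h] by (simp add: field_simps)
    then show ?thesis using h by (simp add: Sig1_def field_simps)
  qed (use left_vacuum in auto)
qed

text \<open>The mass flux \<open>hls * (us - S1)\<close> through the left wave is \<open>cl\<close>,
  which is positive, and so is \<open>hls\<close>.\<close>

lemma S1_le_S2: "S1 \<le> S2"
proof (cases "hl = 0")
  case False
  then have h: "0 < hl" using h_nonneg by simp
  have "0 < hls * (us - S1)" using left_mass cl_pos[OF h] by simp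
  then show ?thesis using left_ratio(1)[OF h] by (simp add: Sig2_def zero_less_mult_iff)
qed (use left_vacuum in auto)

lemma wet_qls: "wet qls"
proof (cases "hl = 0")
  case False
  then have h: "0 < hl" using h_nonneg by simp
  then show ?thesis using left_ratio(1)[OF h] wet_l
    by (auto simp: wet_def sxx_def[of qls] szz_def[of qls] qLstar_sel)
qed (use left_vacuum in \<open>auto simp: wet_def\<close>)

text \<open>For \<open>hls = 0\<close> the velocity \<open>uu qls\<close> is 0 by the division
  convention and may differ from \<open>us\<close>; only the products agree.\<close>

lemma uu_qls: "hls * uu qls = hls * us"
  by (simp add: uu_def qLstar_sel)

text \<open>The CFL condition bounds wave speeds only, whereas the cell velocity itself enters the
  positivity estimate. For \<open>ul < 0\<close> the left wave is faster than \<open>ul\<close>; for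
  \<open>ul\<close> nonnegative with a nonempty right side, \<open>S3\<close> is at least
  \<open>ul\<close>.\<close>

lemma abs_ul_le: "0 < hl \<Longrightarrow> \<bar>ul\<bar> \<le> Amax g eta lam ql qr"
proof -
  assume h: "0 < hl"
  have S1: "S1 = ul - al - 2 * XL" using h by (simp add: Sig1_def cl_eq)
  have a: "0 < al" using aa_pos[OF wet_l h] .
  consider "ul < 0" | "0 \<le> ul" "hr = 0" | "0 \<le> ul" "0 < hr" using h_nonneg by linarith
  then have "\<bar>ul\<bar> \<le> \<bar>S1\<bar> \<or> \<bar>ul\<bar> \<le> \<bar>S3\<bar>"
  proof cases
    case 1
    then show ?thesis using S1 a XL_nonneg by linarith
  next
    case 2
    \<comment> \<open>A vacuum on the right has \<open>ur = 0\<close>, so \<open>XL\<close> already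
      contains \<open>ul\<close>; the term \<open>2 * XL\<close> then pushes \<open>S1\<close> below
      \<open>-ul\<close>.\<close>
    have "ul \<le> XL"
      unfolding XL_def using 2 right_vacuum h a
      by (intro add_increasing2 divide_nonneg_nonneg) auto
    then show ?thesis using S1 a 2 XL_nonneg by linarith
  next
    case 3
    have "S3 = ur + (ar + 2 * (max 0 (ul - ur) + max 0 (Pl - Pr) / (hl * al + hr * ar)))"
      using 3 by (simp add: Sig3_def cR_def)
    moreover have "0 \<le> max 0 (Pl - Pr) / (hl * al + hr * ar)"
      using h_nonneg a aa_nonneg[OF wet_r] by (intro divide_nonneg_nonneg) auto
    moreover have "ul - ur \<le> max 0 (ul - ur)" "0 \<le> max 0 (ul - ur)" by auto
    ultimately have "ul \<le> S3" using aa_nonneg[OF wet_r] by argo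
    then show ?thesis using 3 by linarith
  qed
  then show ?thesis by (auto simp: Amax_def)
qed

end

context riemann begin

interpretation m: riemann g eta lam "mir qr" "mir ql" by (rule riemann_mir)

lemma right_ratio:
  assumes "0 < hr"
  shows "0 < hrs" "hr / hrs = 1 + hr * (ur - us) / cr"
  using m.left_ratio(1,2) assms by (simp_all add: mir_star)

lemma right_mass: "hr * (S3 - ur) = cr" "hrs * (S3 - us) = cr"
  using m.left_mass by (simp_all add: mir_star)

lemma S2_le_S3: "S2 \<le> S3"
  using m.S1_le_S2 by (simp add: mir_star Sig2_def)

lemma wet_qrs: "wet qrs"
  using wet_mir[OF m.wet_qls] by (simp add: qLstar_mir)

lemma abs_ur_le: "0 < hr \<Longrightarrow> \<bar>ur\<bar> \<le> Amax g eta lam ql qr"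
  using m.abs_ul_le by (simp add: Amax_def mir_star Sig2_def max.commute max.left_commute)

end

section \<open>Rankine-Hugoniot relations\<close>

text \<open>Each \<open>min 0 s\<close> keeps the waves travelling left, and by the jump relations
  adding their contributions moves the flux from the leftmost state to the ray at speed 0. A wave of
  speed exactly 0 has no flux jump, so the choice made at ties is immaterial.\<close>

lemma flux_select:
  fixes f0 f1 f2 f3 s1 s2 s3 w0 w1 w2 w3 :: real
  assumes "f1 - f0 = s1 * (w1 - w0)" "f2 - f1 = s2 * (w2 - w1)" "f3 - f2 = s3 * (w3 - w2)"
    and "s1 \<le> s2" "s2 \<le> s3"
  shows "(if 0 < s1 then f0 else if 0 < s2 then f1 else if 0 < s3 then f2 else f3)
    = f0 + min 0 s1 * (w1 - w0) + min 0 s2 * (w2 - w1) + min 0 s3 * (w3 - w2)"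
  using assms by (auto simp: min_def not_less)

lemma wet_sel:
  assumes "wet q"
  shows "hu q = hh q * uu q" "hsxx q = hh q * sxx q" "hszz q = hh q * szz q"
  using assms by (auto simp: wet_def uu_def sxx_def szz_def)

lemma wet_nonneg:
  assumes "wet q"
  shows "0 \<le> hh q" "0 \<le> hsxx q" "0 \<le> hszz q" "0 \<le> sxx q" "0 \<le> szz q"
  using assms by (auto simp: wet_def wet_sel[OF assms])

context riemann
begin

interpretation m: riemann g eta lam "mir qr" "mir ql" by (rule riemann_mir)

lemma qs_sel:
  "hh qls = hls" "hu qls = hls * us" "hh qrs = hrs" "hu qrs = hrs * us"
  using qLstar_sel(1)[of g eta lam "mir qr" "mir ql"] qLstar_sel(2)[of g eta lam "mir qr" "mir ql"]
  by (simp_all add: qLstar_sel qLstar_mir mir_star)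

lemma mass_jumps:
  "hu qls - hu ql = S1 * (hh qls - hh ql)"
  "hu qrs - hu qls = S2 * (hh qrs - hh qls)"
  "hu qr - hu qrs = S3 * (hh qr - hh qrs)"
  using left_mass right_mass by (simp_all add: qs_sel Sig2_def wet_sel wet_l wet_r algebra_simps)

lemma momentum_jump_l:
  "(hu qls * us + ps) - (hu ql * ul + Pl) = S1 * (hu qls - hu ql)"
proof -
  have "hu qls * us - hu ql * ul - S1 * (hu qls - hu ql) = hls * (us - S1) * us - hl * (ul - S1) * ul"
    by (simp add: qs_sel wet_sel wet_l algebra_simps)
  also have "\<dots> = cl * (us - ul)" unfolding left_mass by (simp add: algebra_simps)
  finally show ?thesis using cl_jump by linarith
qed

text \<open>The relation \<open>cl * (us - ul) = Pl - ps\<close> makes the change of kinetic and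
  internal energy balance the pressure work exactly. The relaxation energy thus obeys a jump
  equality, like mass and momentum.\<close>

lemma energy_jump_l:
  "(EhatL g eta lam ql qr + ps) * us - GG g eta lam ql = S1 * (EhatL g eta lam ql qr - EE g eta lam ql)"
proof (cases "hl = 0")
  case True
  then have v: "ql = 0" "cl = 0" "hls = 0" using left_vacuum by auto
  then have "ps = 0" using cl_jump by simp
  then show ?thesis using v by (simp add: EhatL_def)
next
  case False
  then have h: "0 < hl" using h_nonneg by simp
  define e where "e = EE g eta lam ql / hl - ul^2 / 2"
  define es where "es = us^2 / 2 + e + (ps^2 - Pl^2) / (2 * cl^2)"
  have c: "0 < cl" using cl_pos[OF h] .
  have p: "ps = Pl - cl * (us - ul)" using cl_jump by simp
  have E: "EE g eta lam ql = hl * (ul^2 / 2 + e)" using h by (simp add: e_def)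
  have Es: "EhatL g eta lam ql qr = hls * es" by (simp add: EhatL_def es_def e_def)
  have "cl * (es - (ul^2 / 2 + e)) + ps * us - Pl * ul = 0"
    using c by (simp add: es_def p field_simps power2_eq_square)
  then have "hls * (us - S1) * es + ps * us - hl * (ul - S1) * (ul^2 / 2 + e) - Pl * ul = 0"
    unfolding left_mass by (simp add: algebra_simps)
  then show ?thesis unfolding GG_def Es E by (simp add: algebra_simps)
qed

end

context riemann
begin

interpretation m: riemann g eta lam "mir qr" "mir ql" by (rule riemann_mir)

lemma momentum_jump_r:
  "(hu qr * ur + Pr) - (hu qrs * us + ps) = S3 * (hu qr - hu qrs)"
  using m.momentum_jump_l by (simp add: qLstar_mir mir_star algebra_simps)

lemma energy_jump_r:
  "GG g eta lam qr - (EhatR g eta lam ql qr + ps) * us = S3 * (EE g eta lam qr - EhatR g eta lam ql qr)"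
  using m.energy_jump_l unfolding EhatR_def[symmetric] by (simp add: mir_star algebra_simps)

lemma Fh_hom_eq: "Fh_hom g eta lam ql qr = FwL g eta lam hh ql qr"
proof -
  have "Fh_hom g eta lam ql qr =
    (if 0 < S1 then hu ql else if 0 < S2 then hu qls else if 0 < S3 then hu qrs else hu qr)"
    by (simp add: Fh_hom_def stateAt0_def)
  then show ?thesis
    unfolding FwL_def wet_sel(1)[OF wet_l, symmetric]
    by (simp add: flux_select[OF mass_jumps S1_le_S2 S2_le_S3])
qed

lemma Fhu_hom_eq: "Fhu_hom g eta lam ql qr = hu ql * ul + Pl
    + min 0 S1 * (hu qls - hu ql) + min 0 S2 * (hu qrs - hu qls) + min 0 S3 * (hu qr - hu qrs)"
proof -
  have u: "hls * uu qls = hls * us" "hrs * uu qrs = hrs * us"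
    using uu_qls m.uu_qls by (simp_all add: qLstar_mir mir_star)
  have "hu qls * uu qls = hu qls * us" "hu qrs * uu qrs = hu qrs * us"
    unfolding qs_sel using u by (metis mult.assoc mult.commute)+
  then have "Fhu_hom g eta lam ql qr =
    (if 0 < S1 then hu ql * ul + Pl else if 0 < S2 then hu qls * us + ps
     else if 0 < S3 then hu qrs * us + ps else hu qr * ur + Pr)"
    by (simp add: Fhu_hom_def stateAt0_def)
  moreover have "(hu qrs * us + ps) - (hu qls * us + ps) = S2 * (hu qrs - hu qls)"
    by (simp add: Sig2_def algebra_simps)
  ultimately show ?thesis
    by (simp add: flux_select[OF momentum_jump_l _ momentum_jump_r S1_le_S2 S2_le_S3])
qed

end

lemma min_zero_eq: "min 0 x = x - max 0 (x::real)"
  by auto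

context riemann
begin

lemma FL_hom_eq: "FL_hom g eta lam ql qr = flux g eta lam ql
    + min 0 S1 *\<^sub>R (qls - ql) + min 0 S2 *\<^sub>R (qrs - qls) + min 0 S3 *\<^sub>R (qr - qrs)"
  unfolding FL_hom_def Fh_hom_eq Fhu_hom_eq flux_def
  using wet_sel(1)[OF wet_l] by (simp add: FwL_def prod_eq_iff st_defs)

text \<open>For \<open>h\<close> and \<open>hu\<close> the jumps weighted by the full speeds
  telescope to the flux difference, so the left and right wave sums give the same flux. The stress
  components have this form by definition and need not agree with those of
  \<open>FL_hom\<close>.\<close>

lemma FR_hom_eq: "FR_hom g eta lam ql qr = flux g eta lam qr
    - max 0 S1 *\<^sub>R (qls - ql) - max 0 S2 *\<^sub>R (qrs - qls) - max 0 S3 *\<^sub>R (qr - qrs)"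
proof -
  have "Fh_hom g eta lam ql qr = hu qr - max 0 S1 * (hh qls - hl) - max 0 S2 * (hh qrs - hh qls)
      - max 0 S3 * (hr - hh qrs)"
    unfolding Fh_hom_eq FwL_def min_zero_eq wet_sel(1)[OF wet_l, symmetric]
    using mass_jumps by (simp add: algebra_simps)
  moreover have "Fhu_hom g eta lam ql qr = hu qr * ur + Pr - max 0 S1 * (hu qls - hu ql)
      - max 0 S2 * (hu qrs - hu qls) - max 0 S3 * (hu qr - hu qrs)"
    unfolding Fhu_hom_eq min_zero_eq
    using momentum_jump_l momentum_jump_r by (simp add: Sig2_def algebra_simps)
  ultimately show ?thesis
    unfolding FR_hom_def flux_def by (simp add: FwR_def st_defs prod_eq_iff)
qed

end

section \<open>Convexity and the energy inequality of the homogeneous solver\<close>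

context viscoelastic begin

text \<open>The gradient of \<open>EE\<close> at the state with primitive variables
  \<open>h\<close>, \<open>u\<close>, \<open>x\<close>, \<open>z\<close>, applied to
  \<open>v\<close>. Keeping \<open>h\<close> as a separate parameter allows \<open>h\<close> to
  change under reconstruction, even to 0, while velocity and stresses stay fixed.\<close>

definition tangent :: "real \<Rightarrow> real \<Rightarrow> real \<Rightarrow> real \<Rightarrow> st \<Rightarrow> real" where
  "tangent h u x z v = (- (u^2) / 2 + g * h - k * (ln x + ln z)) * hh v + u * hu v
     + k * (1 - 1 / x) * hsxx v + k * (1 - 1 / z) * hszz v"

lemma tangent_linear:
  "tangent h u x z (v + w) = tangent h u x z v + tangent h u x z w"
  "tangent h u x z (v - w) = tangent h u x z v - tangent h u x z w"
  "tangent h u x z (r *\<^sub>R v) = r * tangent h u x z v"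
  by (simp_all add: tangent_def st_linear distrib_left right_diff_distrib mult.left_commute)

lemma ln_tangent: "0 < x \<Longrightarrow> 0 < y \<Longrightarrow> y * (1 - 1 / x) - ln x \<le> y - ln y - (1::real)"
  using ln_le_minus_one[of "y / x"] by (simp add: ln_div algebra_simps)

lemma EE_wet: "0 < sxx q \<Longrightarrow> 0 < szz q \<Longrightarrow>
   EE g eta lam q = hh q * (uu q)^2 / 2 + g * (hh q)^2 / 2
     + k * hh q * ((sxx q - ln (sxx q) - 1) + (szz q - ln (szz q) - 1))"
  unfolding EE_def k_fold by (simp add: ln_mult algebra_simps)

text \<open>Convexity of the energy. The gap consists of \<open>hh q * (uu q - u)^2 / 2\<close>,
  \<open>g * (hh q - h)^2 / 2\<close> and \<open>k * hh q\<close> times the convexity remainders of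
  \<open>s - ln s\<close> in the two stresses. The constant \<open>g * h^2 / 2\<close> appears
  because the gravity term is quadratic in \<open>h\<close> and the rest is homogeneous of degree
  1.\<close>

lemma tangent_le_EE:
  assumes "0 < x" "0 < z" and q: "q = 0 \<or> adm q"
  shows "tangent h u x z q - g * h^2 / 2 \<le> EE g eta lam q"
proof (cases "q = 0")
  case True
  then show ?thesis using g_pos by (simp add: tangent_def)
next
  case False
  then have a: "0 < hh q" "0 < sxx q" "0 < szz q" using q by (auto simp: adm_def)
  then have w: "wet q" by (simp add: wet_def)
  have "sxx q * (1 - 1 / x) - ln x + (szz q * (1 - 1 / z) - ln z)
     \<le> (sxx q - ln (sxx q) - 1) + (szz q - ln (szz q) - 1)"
    using ln_tangent a assms by (intro add_mono) auto
  then have "k * hh q * (sxx q * (1 - 1 / x) - ln x + (szz q * (1 - 1 / z) - ln z))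
     \<le> k * hh q * ((sxx q - ln (sxx q) - 1) + (szz q - ln (szz q) - 1))"
    using k_pos a by (intro mult_left_mono mult_nonneg_nonneg) auto
  moreover have "0 \<le> hh q * (uu q - u)^2 / 2" "0 \<le> g * (hh q - h)^2 / 2"
    using a g_pos by auto
  ultimately show ?thesis
    unfolding EE_wet[OF a(2,3)] tangent_def wet_sel[OF w]
    by (simp add: algebra_simps power2_eq_square)
qed

text \<open>The alternative \<open>q = 0\<close>, \<open>h = 0\<close> leaves \<open>u\<close>
  arbitrary and \<open>x\<close>, \<open>z\<close> arbitrary positive: a dry reconstructed state is
  tested with the velocity and stresses of its cell.\<close>

lemma tangent_at:
  assumes "0 < x" "0 < z" and q: "q = 0 \<and> h = 0 \<or> adm q \<and> h = hh q \<and> u = uu q \<and> x = sxx q \<and> z = szz q"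
  shows "tangent h u x z q = EE g eta lam q + g * h^2 / 2"
    and "tangent h u x z (flux g eta lam q) = GG g eta lam q + g * h^2 * u / 2"
proof -
  show "tangent h u x z q = EE g eta lam q + g * h^2 / 2"
  proof (cases "q = 0 \<and> h = 0")
    case False
    then have a: "0 < hh q" "0 < sxx q" "0 < szz q" and e: "h = hh q" "u = uu q" "x = sxx q" "z = szz q"
      using q by (auto simp: adm_def)
    then have w: "wet q" by (simp add: wet_def)
    show ?thesis unfolding EE_wet[OF a(2,3)] tangent_def wet_sel[OF w] e using a
      by (simp add: field_simps power2_eq_square)
  qed (simp add: tangent_def)
  show "tangent h u x z (flux g eta lam q) = GG g eta lam q + g * h^2 * u / 2"
  proof (cases "q = 0 \<and> h = 0")
    case False
    then have a: "0 < hh q" "0 < sxx q" "0 < szz q" and e: "h = hh q" "u = uu q" "x = sxx q" "z = szz q"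
      using q by (auto simp: adm_def)
    then have w: "wet q" by (simp add: wet_def)
    have f: "hh (flux g eta lam q) = hu q" "hu (flux g eta lam q) = hu q * uu q + PP g eta lam q"
      "hsxx (flux g eta lam q) = hsxx q * uu q" "hszz (flux g eta lam q) = hszz q * uu q"
      by (simp_all add: flux_def st_defs)
    have k2: "sxx q * (1 - 1 / sxx q) = sxx q - 1" "szz q * (1 - 1 / szz q) = szz q - 1"
      using a by (simp_all add: algebra_simps)
    have "tangent h u x z (flux g eta lam q) = 
     (- ((uu q)^2) / 2 + g * hh q - k * (ln (sxx q) + ln (szz q))) * (hh q * uu q) +
      uu q * (hh q * uu q * uu q + PP g eta lam q) +
       k * hh q * uu q * (sxx q * (1 - 1 / sxx q)) + k * hh q * uu q * (szz q * (1 - 1 / szz q))"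
      unfolding tangent_def f wet_sel[OF w] e by (simp add: algebra_simps)
    also have "\<dots> = GG g eta lam q + g * h^2 * u / 2"
      unfolding k2 GG_def EE_wet[OF a(2,3)] e by (simp add: algebra_simps power2_eq_square)
    finally show ?thesis .
  qed (simp add: tangent_def)
qed

lemma GDERIV_Et:
  assumes "adm q"
  shows "GDERIV (\<lambda>q'. Et g eta lam q' b) q :>
    (- ((uu q)^2) / 2 + g * (hh q + b) - k * (ln (sxx q) + ln (szz q)), uu q,
       k * (1 - 1 / sxx q), k * (1 - 1 / szz q))"
proof -
  have h: "0 < hh q" "0 < sxx q" "0 < szz q"
    using assms by (auto simp: adm_def)
  have prim: "((\<lambda>q. f q / hh q) has_derivative (\<lambda>v. (f v - f q / hh q * hh v) / hh q)) (at q)"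
    if "bounded_linear f" for f :: "st \<Rightarrow> real"
  proof -
    have "bounded_linear hh" unfolding hh_def[abs_def] by (rule bounded_linear_fst)
    note d = bounded_linear_imp_has_derivative[OF this] bounded_linear_imp_has_derivative[OF that]
    show ?thesis
      by (rule has_derivative_eq_rhs, rule has_derivative_divide[OF d(2,1)])
         (use h in \<open>auto simp: fun_eq_iff field_simps\<close>)
  qed
  have bl: "bounded_linear hh" "bounded_linear hu" "bounded_linear hsxx" "bounded_linear hszz"
    unfolding st_defs[abs_def]
    by (auto intro!: bounded_linear_fst bounded_linear_snd bounded_linear_compose[OF bounded_linear_fst]
        bounded_linear_compose[OF bounded_linear_snd])
  note d [derivative_intros] = bounded_linear_imp_has_derivative[OF bl(1)]
     prim[OF bl(2), folded uu_def] prim[OF bl(3), folded sxx_def] prim[OF bl(4), folded szz_def]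
  show ?thesis
    unfolding gderiv_def Et_def EE_def k_fold
    apply (rule has_derivative_eq_rhs)
     apply (rule derivative_eq_intros refl | (use h in simp; fail))+
    using h by (simp add: fun_eq_iff inner_st ln_mult field_simps power2_eq_square)
qed

text \<open>\<open>gradEt\<close> is only chosen by \<open>SOME\<close>; uniqueness of the
  derivative identifies it with the explicit gradient.\<close>

lemma inner_gradEt:
  assumes "adm q"
  shows "gradEt g eta lam q b \<bullet> v = tangent (hh q) (uu q) (sxx q) (szz q) v + g * b * hh v"
proof -
  let ?D = "(- ((uu q)^2) / 2 + g * (hh q + b) - k * (ln (sxx q) + ln (szz q)), uu q,
       k * (1 - 1 / sxx q), k * (1 - 1 / szz q))"
  note D = GDERIV_Et[OF assms, of b]
  have "GDERIV (\<lambda>q'. Et g eta lam q' b) q :> gradEt g eta lam q b"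
    unfolding gradEt_def by (rule someI) (rule D)
  then have "(\<lambda>v. v \<bullet> gradEt g eta lam q b) = (\<lambda>v. v \<bullet> ?D)"
    using D unfolding gderiv_def by (rule has_derivative_unique)
  then have "v \<bullet> gradEt g eta lam q b = v \<bullet> ?D" by metis
  then show ?thesis
    by (simp add: inner_commute[of _ v] tangent_def inner_st algebra_simps)
qed

end

section \<open>Subcharacteristic condition and domination by the relaxation energy\<close>

context riemann
begin

interpretation m: riemann g eta lam "mir qr" "mir ql" by (rule riemann_mir)

text \<open>Inserting the bound on \<open>hl / hls\<close> reduces the claim to
  \<open>(al + 2 * XL) * al\<close> being at most \<open>(al + XL)^2\<close>. The factor 2 in the
  speeds makes the terms linear in \<open>XL\<close> cancel, leaving the slack
  \<open>XL^2\<close>.\<close>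

lemma subcharacteristic:
  assumes "0 < hl"
  shows "(hls / hl)^2 * al \<le> cl / hl"
proof -
  have a: "0 < al" using aa_pos[OF wet_l assms] .
  have X: "0 \<le> XL" by (rule XL_nonneg)
  have s: "0 < hls" "(al + XL) / (al + 2 * XL) \<le> hl / hls" using left_ratio[OF assms] by auto
  have "hls / hl = inverse (hl / hls)" by simp
  also have "\<dots> \<le> inverse ((al + XL) / (al + 2 * XL))"
    using s(2) a X by (intro le_imp_inverse_le) auto
  finally have y: "hls / hl \<le> (al + 2 * XL) / (al + XL)" by simp
  have "(hls / hl)^2 * al \<le> ((al + 2 * XL) / (al + XL))^2 * al"
    using y s(1) assms a by (intro mult_right_mono power_mono) auto
  also have "\<dots> = (al + 2 * XL) * ((al + 2 * XL) * al / (al + XL)^2)"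
    by (simp add: power2_eq_square)
  also have "\<dots> \<le> (al + 2 * XL) * 1"
  proof (intro mult_left_mono)
    have "(al + 2 * XL) * al \<le> (al + XL)^2" by (simp add: power2_eq_square algebra_simps)
    then show "(al + 2 * XL) * al / (al + XL)^2 \<le> 1" using a X by (simp add: divide_le_eq_1)
  qed (use a X in simp)
  also have "\<dots> = cl / hl" using assms by (simp add: cl_eq)
  finally show ?thesis .
qed

end

context viscoelastic
begin

text \<open>Along the curve of states with \<open>h\<^sup>2 \<sigma>\<^sub>x\<^sub>x\<close> and \<open>\<sigma>\<^sub>z\<^sub>z / h\<^sup>2\<close> frozen, the specific energy
  is a function of \<open>1/h\<close> with derivative \<open>-P\<close>. Below is its second-order Taylor estimate,
  \<open>t / h\<close> being the increment of \<open>1/h\<close>.\<close>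

lemma specific_energy_taylor:
  fixes h x z y C M t :: real
  assumes "0 \<le> h" "0 \<le> x" "0 \<le> z" "0 < y" and t: "t = 1 / y - 1"
    and M: "1 \<le> M" "y^4 \<le> M" and C: "M * (g * h + 2 * k * (3 * z + x)) \<le> C"
  shows "g * h * y / 2 + k * (x / y^2 + z * y^2)
    \<le> g * h / 2 + k * (x + z) - (g * h / 2 + 2 * k * (z - x)) * t + C * t^2 / 2"
proof -
  have t2: "t^2 = (y - 1)^2 / y^2" using assms by (simp add: t field_simps power2_eq_square)
  \<comment> \<open>A single bound \<open>M\<close> on 1 and \<open>y^4\<close> controls the
    remainders below, whose coefficients involve \<open>y\<close> and \<open>y^2\<close>.\<close>
  have yM: "y \<le> M" "y^2 \<le> M"
  proof -
    have "y \<le> max 1 (y^4)" "y^2 \<le> max 1 (y^4)"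
      using assms(4) self_le_power[of y 4] power_increasing[of 2 4 y] power_le_one[of y 2]
      by (cases "1 \<le> y"; auto)+
    then show "y \<le> M" "y^2 \<le> M" using M by auto
  qed
  have 1: "y \<le> 1 - t + M * t^2"
  proof -
    have "y - (1 - t) = y * t^2" using assms(4) unfolding t2 by (simp add: t field_simps power2_eq_square)
    also have "\<dots> \<le> M * t^2" using yM by (intro mult_right_mono) auto
    finally show ?thesis by simp
  qed
  have 2: "1 / y^2 = 1 + 2 * t + t^2" using assms(4) by (simp add: t field_simps power2_eq_square)
  \<comment> \<open>The remainder is exact, with coefficient \<open>y^2 + 2 * y\<close>. The
    resulting 3 is the weight of \<open>szz\<close> in the squared sound speed.\<close>
  have 3: "y^2 \<le> 1 - 2 * t + 3 * M * t^2"
  proof -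
    have "y^2 - (1 - 2 * t) = (y^2 + 2 * y) * t^2"
      using assms(4) unfolding t2 by (simp add: t field_simps power2_eq_square)
    also have "\<dots> \<le> (3 * M) * t^2" using yM by (intro mult_right_mono) auto
    finally show ?thesis by simp
  qed
  have "x * t^2 \<le> x * (M * t^2)" using assms M mult_right_mono[of 1 M "t^2"] by (intro mult_left_mono) auto
  then have 4: "x * (1 / y^2) \<le> x * (1 + 2 * t + M * t^2)" unfolding 2 by (simp add: algebra_simps)
  have "g * h / 2 * y + k * (x * (1 / y^2)) + k * (z * y^2)
    \<le> g * h / 2 * (1 - t + M * t^2) + k * (x * (1 + 2 * t + M * t^2)) + k * (z * (1 - 2 * t + 3 * M * t^2))"
    using mult_left_mono[OF 1, of "g * h / 2"] mult_left_mono[OF 4, of k]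
      mult_left_mono[OF mult_left_mono[OF 3, of z], of k] assms(1,3) g_pos k_pos
    by (intro add_mono) auto
  also have "\<dots> = g * h / 2 + k * (x + z) - (g * h / 2 + 2 * k * (z - x)) * t
     + (M * (g * h + 2 * k * (3 * z + x))) * t^2 / 2"
    by (simp add: field_simps)
  also have "\<dots> \<le> g * h / 2 + k * (x + z) - (g * h / 2 + 2 * k * (z - x)) * t + C * t^2 / 2"
    using mult_right_mono[OF C, of "t^2"] by simp
  finally show ?thesis by (simp add: algebra_simps)
qed

end

context riemann
begin

text \<open>Both energies have the same kinetic part, and the logarithm is unchanged because the
  product of the stresses is preserved across the wave. What remains is the Taylor estimate with
  \<open>C = (cl / hl)^2\<close>, admissible since \<open>cl / hl\<close> dominates both
  \<open>al\<close> and, by the subcharacteristic condition, \<open>y^2 * al\<close>.\<close>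

lemma EE_le_EhatL:
  assumes "ql = 0 \<or> adm ql"
  shows "EE g eta lam qls \<le> EhatL g eta lam ql qr"
proof (cases "hl = 0")
  case True
  then have "hls = 0" "qls = 0" using left_vacuum by auto
  then show ?thesis unfolding EhatL_def by simp
next
  case False
  then have h: "0 < hl" "0 < sxx ql" "0 < szz ql" using assms by (auto simp: adm_def)
  define y where "y = hls / hl"
  define t where "t = hl * (us - ul) / cl"
  define C where "C = (cl / hl)^2"
  have c: "0 < cl" using cl_pos[OF h(1)] .
  have s: "0 < hls" using left_ratio[OF h(1)] by auto
  have y: "0 < y" "hls = y * hl" using s h by (auto simp: y_def)
  have ty: "t = 1 / y - 1" using left_ratio(2)[OF h(1)] by (simp add: t_def y_def)
  have a: "0 < al" using aa_pos[OF wet_l h(1)] .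
  have C: "max 1 (y^4) * (g * hl + 2 * k * (3 * szz ql + sxx ql)) \<le> C"
  proof -
    have "al \<le> cl / hl" using cl_ge h by (simp add: field_simps)
    moreover have "y^2 * al \<le> cl / hl" unfolding y_def by (rule subcharacteristic) fact
    ultimately have "al^2 \<le> C" "(y^2 * al)^2 \<le> C"
      unfolding C_def using a by (auto intro!: power_mono)
    moreover have "(y^2 * al)^2 = y^4 * al^2" by (simp add: power_mult_distrib flip: power_mult)
    ultimately have "max 1 (y^4) * al^2 \<le> C" by (auto simp: max_def)
    then show ?thesis by (simp add: aa_sq[OF wet_l])
  qed
  have core: "g * hl * y / 2 + k * (sxx ql / y^2 + szz ql * y^2)
    \<le> g * hl / 2 + k * (sxx ql + szz ql) - (g * hl / 2 + 2 * k * (szz ql - sxx ql)) * t + C * t^2 / 2"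
    by (rule specific_energy_taylor[OF _ _ _ y(1) ty _ _ C]) (use h in auto)
  have prim: "uu qls = us" "sxx qls = sxx ql / y^2" "szz qls = szz ql * y^2"
    using s h by (simp_all add: uu_def sxx_def[of qls] szz_def[of qls] qLstar_sel y_def power_divide)
  have "sxx qls * szz qls = sxx ql * szz ql" using y(1) by (simp add: prim)
  then have E: "EE g eta lam qls = hls * (us^2 / 2 + (g * hl * y / 2 + k * (sxx ql / y^2 + szz ql * y^2))
     - k * (ln (sxx ql * szz ql) + 2))"
    unfolding EE_def k_fold qs_sel prim
    by (simp add: y(2) algebra_simps power2_eq_square)
  have El: "EE g eta lam ql / hl - ul^2 / 2 = g * hl / 2 + k * (sxx ql + szz ql) - k * (ln (sxx ql * szz ql) + 2)"
    unfolding EE_def k_fold using h by (simp add: field_simps power2_eq_square)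
  have ps: "ps = Pl - C * hl * t"
  proof -
    have "C * hl * t = cl * (us - ul)" using c h by (simp add: C_def t_def power2_eq_square)
    then show ?thesis using cl_jump by simp
  qed
  have cC: "cl^2 = C * hl^2" "0 < C" using h c by (auto simp: C_def power_divide)
  have "(ps^2 - Pl^2) / (2 * cl^2) = C * t^2 / 2 - Pl / hl * t"
    unfolding ps cC(1) using h cC(2) by (simp add: field_simps power2_eq_square)
  also have "Pl / hl = g * hl / 2 + 2 * k * (szz ql - sxx ql)"
    unfolding PP_def k_fold using h by (simp add: field_simps power2_eq_square)
  finally have pi: "(ps^2 - Pl^2) / (2 * cl^2) = C * t^2 / 2 - (g * hl / 2 + 2 * k * (szz ql - sxx ql)) * t" .
  have "EhatL g eta lam ql qr = hls * (us^2 / 2 + (EE g eta lam ql / hl - ul^2 / 2)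
      + (ps^2 - Pl^2) / (2 * cl^2))"
    unfolding EhatL_def by (simp add: algebra_simps)
  then show ?thesis
    unfolding E El pi using core s by (simp add: mult_left_mono)
qed

lemma adm_qls: "ql = 0 \<or> adm ql \<Longrightarrow> qls = 0 \<or> adm qls"
  using left_vacuum left_ratio(1)
  by (cases "hl = 0") (auto simp: adm_def sxx_def[of qls] szz_def[of qls] qLstar_sel)

end

context riemann
begin

interpretation m: riemann g eta lam "mir qr" "mir ql" by (rule riemann_mir)

lemma mir_adm: "(mir q = 0 \<or> adm (mir q)) = (q = 0 \<or> adm q)"
  using mir_simps(8)[of q] by (auto simp: adm_def simp del: mir_simps(8))

lemma EE_le_EhatR: "qr = 0 \<or> adm qr \<Longrightarrow> EE g eta lam qrs \<le> EhatR g eta lam ql qr"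
  using m.EE_le_EhatL[unfolded mir_adm] by (simp add: EhatR_def qLstar_mir)

lemma adm_qrs: "qr = 0 \<or> adm qr \<Longrightarrow> qrs = 0 \<or> adm qrs"
  using m.adm_qls[unfolded mir_adm] by (simp add: qLstar_mir mir_adm)

end

section \<open>Energy flux of the homogeneous solver\<close>

text \<open>The flux of the relaxation energy at speed 0, as a wave sum. The middle energies are
  those of the relaxation system, for which the jump relations are exact, so that the sum started
  from the right gives the same value.\<close>

definition Ghom :: "real \<Rightarrow> real \<Rightarrow> real \<Rightarrow> st \<Rightarrow> st \<Rightarrow> real" where
  "Ghom g eta lam ql qr = GG g eta lam ql
     + min 0 (Sig1 g eta lam ql qr) * (EhatL g eta lam ql qr - EE g eta lam ql)
     + min 0 (Sig2 g eta lam ql qr) * (EhatR g eta lam ql qr - EhatL g eta lam ql qr)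
     + min 0 (Sig3 g eta lam ql qr) * (EE g eta lam qr - EhatR g eta lam ql qr)"

text \<open>Summation by parts: the difference of the two sides is \<open>(m2 - m1) * (e1 - t1) +
  (m3 - m2) * (e2 - t2) - m3 * (e3 - t3)\<close>. A gap at index 0 would enter with the coefficient
  \<open>m1\<close>, which has the wrong sign, hence the equality there.\<close>

lemma weighted_jumps:
  fixes m1 m2 m3 :: real
  assumes "m1 \<le> m2" "m2 \<le> m3" "m3 \<le> 0"
    and "t0 = e0" "t1 \<le> e1" "t2 \<le> e2" "t3 \<le> e3"
  shows "m1 * (e1 - e0) + m2 * (e2 - e1) + m3 * (e3 - e2)
    \<le> m1 * (t1 - t0) + m2 * (t2 - t1) + m3 * (t3 - t2)"
proof -
  have "0 \<le> (m2 - m1) * (e1 - t1)" "0 \<le> (m3 - m2) * (e2 - t2)" "0 \<le> - m3 * (e3 - t3)"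
    using assms by (auto intro!: mult_nonneg_nonneg mult_nonpos_nonneg)
  then show ?thesis using assms(4) by (simp add: algebra_simps)
qed

lemma weighted_jumps_right:
  fixes m1 m2 m3 :: real
  assumes "0 \<le> m1" "m1 \<le> m2" "m2 \<le> m3"
    and "t0 \<le> e0" "t1 \<le> e1" "t2 \<le> e2" "t3 = e3"
  shows "m1 * (e1 - e0) + m2 * (e2 - e1) + m3 * (e3 - e2)
    \<le> m1 * (t1 - t0) + m2 * (t2 - t1) + m3 * (t3 - t2)"
proof -
  have "0 \<le> m1 * (e0 - t0)" "0 \<le> (m2 - m1) * (e1 - t1)" "0 \<le> (m3 - m2) * (e2 - t2)"
    using assms by (auto intro!: mult_nonneg_nonneg)
  then show ?thesis using assms(7) by (simp add: algebra_simps)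
qed

context riemann
begin

lemma Ghom_eq_right: "Ghom g eta lam ql qr = GG g eta lam qr
   - max 0 S1 * (EhatL g eta lam ql qr - EE g eta lam ql)
   - max 0 S2 * (EhatR g eta lam ql qr - EhatL g eta lam ql qr)
   - max 0 S3 * (EE g eta lam qr - EhatR g eta lam ql qr)"
  unfolding Ghom_def min_zero_eq
  using energy_jump_l energy_jump_r by (simp add: Sig2_def algebra_simps)

text \<open>The tangent plane at the left state touches the energy there and lies below it at the
  other states, where the relaxation energies are larger still. Summation by parts with the weights
  \<open>min 0 S1\<close>, \<open>min 0 S2\<close>, \<open>min 0 S3\<close> compares the two
  fluxes.\<close>

lemma Ghom_le:
  assumes l: "ql = 0 \<or> adm ql" and r: "qr = 0 \<or> adm qr" and "0 < x" "0 < z"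
    and d: "ql = 0 \<and> h = 0 \<or> adm ql \<and> h = hh ql \<and> u = uu ql \<and> x = sxx ql \<and> z = szz ql"
  shows "Ghom g eta lam ql qr \<le> tangent h u x z (FL_hom g eta lam ql qr) - g * h^2 * u / 2"
proof -
  let ?T = "\<lambda>q. tangent h u x z q - g * h^2 / 2"
  note T = tangent_le_EE[OF assms(3,4)]
  have b: "?T ql = EE g eta lam ql" "?T qls \<le> EhatL g eta lam ql qr"
      "?T qrs \<le> EhatR g eta lam ql qr" "?T qr \<le> EE g eta lam qr"
    using tangent_at(1)[OF assms(3,4) d] order_trans[OF T[OF adm_qls[OF l]] EE_le_EhatL[OF l]]
      order_trans[OF T[OF adm_qrs[OF r]] EE_le_EhatR[OF r]] T[OF r] by simp_all
  have "Ghom g eta lam ql qr \<le> GG g eta lam ql + (min 0 S1 * (?T qls - ?T ql)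
      + min 0 S2 * (?T qrs - ?T qls) + min 0 S3 * (?T qr - ?T qrs))"
    unfolding Ghom_def add.assoc
    using weighted_jumps[OF _ _ _ b, of "min 0 S1" "min 0 S2" "min 0 S3"] S1_le_S2 S2_le_S3
    by (simp add: add.assoc)
  also have "\<dots> = tangent h u x z (FL_hom g eta lam ql qr) - g * h^2 * u / 2"
    unfolding FL_hom_eq tangent_linear tangent_at(2)[OF assms(3,4) d] by simp
  finally show ?thesis .
qed

lemma Ghom_ge:
  assumes l: "ql = 0 \<or> adm ql" and r: "qr = 0 \<or> adm qr" and "0 < x" "0 < z"
    and d: "qr = 0 \<and> h = 0 \<or> adm qr \<and> h = hh qr \<and> u = uu qr \<and> x = sxx qr \<and> z = szz qr"
  shows "tangent h u x z (FR_hom g eta lam ql qr) - g * h^2 * u / 2 \<le> Ghom g eta lam ql qr"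
proof -
  let ?T = "\<lambda>q. tangent h u x z q - g * h^2 / 2"
  note T = tangent_le_EE[OF assms(3,4)]
  have b: "?T ql \<le> EE g eta lam ql" "?T qls \<le> EhatL g eta lam ql qr"
      "?T qrs \<le> EhatR g eta lam ql qr" "?T qr = EE g eta lam qr"
    using tangent_at(1)[OF assms(3,4) d] order_trans[OF T[OF adm_qls[OF l]] EE_le_EhatL[OF l]]
      order_trans[OF T[OF adm_qrs[OF r]] EE_le_EhatR[OF r]] T[OF l] by simp_all
  have "tangent h u x z (FR_hom g eta lam ql qr) - g * h^2 * u / 2
    = GG g eta lam qr - (max 0 S1 * (?T qls - ?T ql)
      + max 0 S2 * (?T qrs - ?T qls) + max 0 S3 * (?T qr - ?T qrs))"
    unfolding FR_hom_eq tangent_linear tangent_at(2)[OF assms(3,4) d] by simp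
  also have "\<dots> \<le> GG g eta lam qr - (max 0 S1 * (EhatL g eta lam ql qr - EE g eta lam ql)
      + max 0 S2 * (EhatR g eta lam ql qr - EhatL g eta lam ql qr)
      + max 0 S3 * (EE g eta lam qr - EhatR g eta lam ql qr))"
    by (rule diff_left_mono, rule weighted_jumps_right[OF _ _ _ b]) (use S1_le_S2 S2_le_S3 in auto)
  also have "\<dots> = Ghom g eta lam ql qr" unfolding Ghom_eq_right by simp
  finally show ?thesis .
qed

lemma FwL_le:
  assumes W: "W \<in> {hh, hsxx, hszz}"
  shows "FwL g eta lam W ql qr \<le> (ul - min 0 S1) * W ql"
    and "(ur - max 0 S3) * W qr \<le> FwR g eta lam W ql qr"
proof -
  have n: "0 \<le> W ql" "0 \<le> W qls" "0 \<le> W qrs" "0 \<le> W qr"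
    using W wet_nonneg(1-3)[OF wet_l] wet_nonneg(1-3)[OF wet_r]
      wet_nonneg(1-3)[OF wet_qls] wet_nonneg(1-3)[OF wet_qrs] by auto
  have "0 \<le> (min 0 S2 - min 0 S1) * W qls" "0 \<le> (min 0 S3 - min 0 S2) * W qrs" "0 \<le> - min 0 S3 * W qr"
    using n S1_le_S2 S2_le_S3 by (auto intro!: mult_nonneg_nonneg mult_nonpos_nonneg)
  then show "FwL g eta lam W ql qr \<le> (ul - min 0 S1) * W ql"
    unfolding FwL_def by (simp add: algebra_simps)
  have "0 \<le> (max 0 S2 - max 0 S1) * W qls" "0 \<le> (max 0 S3 - max 0 S2) * W qrs" "0 \<le> max 0 S1 * W ql"
    using n S1_le_S2 S2_le_S3 by (auto intro!: mult_nonneg_nonneg)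
  then show "(ur - max 0 S3) * W qr \<le> FwR g eta lam W ql qr"
    unfolding FwR_def by (simp add: algebra_simps)
qed

lemma Fh_hom_eq_right: "Fh_hom g eta lam ql qr = FwR g eta lam hh ql qr"
  using arg_cong[OF FR_hom_eq, of hh]
  by (simp add: FR_hom_def FwR_def st_linear wet_sel(1)[OF wet_r, symmetric])
     (simp add: st_defs flux_def)

text \<open>An empty side has no mass to send across the interface.\<close>

lemma Fh_hom_left_vacuum: "hl = 0 \<Longrightarrow> Fh_hom g eta lam ql qr \<le> 0"
  using FwL_le(1)[of hh] by (simp add: Fh_hom_eq)

lemma Fh_hom_right_vacuum: "hr = 0 \<Longrightarrow> 0 \<le> Fh_hom g eta lam ql qr"
  using FwL_le(2)[of hh] by (simp add: Fh_hom_eq_right)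

end

section \<open>Hydrostatic reconstruction\<close>

lemma recon_zero: "recon q 0 = 0"
  by (simp add: recon_def zero_prod_def)

lemma recon_sel:
  assumes "0 < hs"
  shows "hh (recon q hs) = hs" "uu (recon q hs) = uu q" "sxx (recon q hs) = sxx q" "szz (recon q hs) = szz q"
  using assms by (auto simp: recon_def st_defs uu_def[of "(_,_)"] sxx_def[of "(_,_)"] szz_def[of "(_,_)"])

lemma hh_recon: "hh (recon q hs) = hs"
  by (simp add: recon_def st_defs)

lemma wet_recon: "0 \<le> hs \<Longrightarrow> 0 \<le> sxx q \<Longrightarrow> 0 \<le> szz q \<Longrightarrow> wet (recon q hs)"
  by (cases "hs = 0") (auto simp: recon_zero wet_def recon_sel)

lemma recon_self: "hh q \<noteq> 0 \<Longrightarrow> recon q (hh q) = q"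
  by (simp add: recon_def uu_def sxx_def szz_def) (simp add: st_defs)

lemma hsharp_bounds:
  "0 \<le> hsharpL q db" "0 \<le> hsharpR q db"
  "0 \<le> hh q \<Longrightarrow> hsharpL q db \<le> hh q" "0 \<le> hh q \<Longrightarrow> hsharpR q db \<le> hh q"
  by (auto simp: hsharpL_def hsharpR_def)

lemma recon_bounds:
  assumes "0 \<le> hh q" "0 \<le> hsxx q" "0 \<le> hszz q" "0 \<le> hs" "hs \<le> hh q" "W \<in> {hh, hsxx, hszz}"
  shows "0 \<le> W (recon q hs)" "W (recon q hs) \<le> W q"
proof -
  have s: "0 \<le> sxx q" "0 \<le> szz q" using assms by (auto simp: sxx_def szz_def)
  have w: "hs * sxx q \<le> hsxx q" "hs * szz q \<le> hszz q"
  proof -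
    have "hs * sxx q \<le> hh q * sxx q" "hs * szz q \<le> hh q * szz q"
      using s assms by (auto intro: mult_right_mono)
    \<comment> \<open>Only inequalities: for \<open>hh q = 0\<close> the left-hand sides vanish by
      the division convention, while the conserved stresses may be positive.\<close>
    moreover have "hh q * sxx q \<le> hsxx q" "hh q * szz q \<le> hszz q"
      using assms by (auto simp: sxx_def szz_def)
    ultimately show "hs * sxx q \<le> hsxx q" "hs * szz q \<le> hszz q" by auto
  qed
  have "hh (recon q hs) = hs" "hsxx (recon q hs) = hs * sxx q" "hszz (recon q hs) = hs * szz q"
    by (simp_all add: recon_def st_defs)
  then show "0 \<le> W (recon q hs)" "W (recon q hs) \<le> W q"
    using s w assms by auto
qed

section \<open>Positivity under the CFL condition\<close>

text \<open>The two interfaces take at most \<open>(1 / 2 + r * u) * wl\<close> and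
  \<open>(1 / 2 - r * u) * wr\<close>. Since \<open>wl\<close> and \<open>wr\<close> are at most
  \<open>w\<close>, both can be replaced by \<open>w\<close> once the weights are nonnegative, and
  then the drift \<open>r * u\<close> cancels.\<close>

lemma half_cells:
  fixes w wl wr u A B r :: real
  assumes "0 \<le> wl" "wl \<le> w" "0 \<le> wr" "wr \<le> w" "0 \<le> r" "r * A \<le> 1 / 2" "r * B \<le> 1 / 2"
    and "L \<le> (u + A) * wl" "(u - B) * wr \<le> R"
    and "wl \<noteq> 0 \<Longrightarrow> \<bar>u\<bar> \<le> A" "wr \<noteq> 0 \<Longrightarrow> \<bar>u\<bar> \<le> B"
  shows "r * (L - R) \<le> w"
\<comment> \<open>With both reconstructed values zero no wave speed controls \<open>u\<close>, but
  then both flux bounds are 0.\<close>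
proof (cases "wl = 0 \<and> wr = 0")
  case True
  then have "r * (L - R) \<le> r * 0" using assms by (intro mult_left_mono) auto
  then show ?thesis using assms by simp
next
  case False
  then have "\<bar>u\<bar> \<le> A \<or> \<bar>u\<bar> \<le> B" using assms by blast
  then have "r * \<bar>u\<bar> \<le> r * A \<or> r * \<bar>u\<bar> \<le> r * B"
    using mult_left_mono[OF _ \<open>0 \<le> r\<close>] by metis
  then have "r * \<bar>u\<bar> \<le> 1 / 2" using assms(6,7) by linarith
  then have "\<bar>r * u\<bar> \<le> 1 / 2" using \<open>0 \<le> r\<close> by (simp add: abs_mult)
  then have u: "0 \<le> 1 / 2 + r * u" "0 \<le> 1 / 2 - r * u" by auto
  have "r * (L - R) \<le> r * ((u + A) * wl - (u - B) * wr)" using assms by (intro mult_left_mono) auto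
  also have "\<dots> = (r * A + r * u) * wl + (r * B - r * u) * wr" by (simp add: algebra_simps)
  also have "\<dots> \<le> (1 / 2 + r * u) * wl + (1 / 2 - r * u) * wr"
    using assms by (intro add_mono[OF mult_right_mono mult_right_mono]) auto
  also have "\<dots> \<le> (1 / 2 + r * u) * w + (1 / 2 - r * u) * w"
    using assms u by (intro add_mono[OF mult_left_mono mult_left_mono]) auto
  finally show ?thesis by (simp add: algebra_simps)
qed

context viscoelastic
begin

lemma FL_FR_comp:
  assumes "riemann g eta lam (qsharpL ql db) (qsharpR qr db)" and W: "W \<in> {hh, hsxx, hszz}"
  shows "W (FL g eta lam ql qr db) = FwL g eta lam W (qsharpL ql db) (qsharpR qr db)"
    and "W (FR g eta lam ql qr db) = FwR g eta lam W (qsharpL ql db) (qsharpR qr db)"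
proof -
  have "hh (FL_hom g eta lam (qsharpL ql db) (qsharpR qr db)) = FwL g eta lam hh (qsharpL ql db) (qsharpR qr db)"
    "hh (FR_hom g eta lam (qsharpL ql db) (qsharpR qr db)) = FwR g eta lam hh (qsharpL ql db) (qsharpR qr db)"
    using riemann.Fh_hom_eq[OF assms(1)] riemann.Fh_hom_eq_right[OF assms(1)]
    by (simp_all add: FL_hom_def FR_hom_def st_defs)
  then show "W (FL g eta lam ql qr db) = FwL g eta lam W (qsharpL ql db) (qsharpR qr db)"
    "W (FR g eta lam ql qr db) = FwR g eta lam W (qsharpL ql db) (qsharpR qr db)"
    using W unfolding insert_iff empty_iff
    by (elim disjE; simp add: FL_def FR_def st_defs FL_hom_def FR_hom_def)+
qed

text \<open>Supplies the hypotheses of \<open>half_cells\<close> at one interface. The cell velocity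
  may replace that of the reconstructed state: they differ only for a dry state, where
  \<open>W\<close> vanishes.\<close>

lemma FL_comp_le:
  fixes db :: real
  assumes pos: "0 \<le> hh ql" "0 \<le> hsxx ql" "0 \<le> hszz ql" "0 \<le> hh qr" "0 \<le> hsxx qr" "0 \<le> hszz qr"
    and W: "W \<in> {hh, hsxx, hszz}"
  defines "A \<equiv> Amax g eta lam (qsharpL ql db) (qsharpR qr db)"
  shows "W (FL g eta lam ql qr db) \<le> (uu ql + A) * W (qsharpL ql db)"
    and "(uu qr - A) * W (qsharpR qr db) \<le> W (FR g eta lam ql qr db)"
    and "W (qsharpL ql db) \<noteq> 0 \<Longrightarrow> \<bar>uu ql\<bar> \<le> A"
    and "W (qsharpR qr db) \<noteq> 0 \<Longrightarrow> \<bar>uu qr\<bar> \<le> A"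
proof -
  have s: "0 \<le> sxx ql" "0 \<le> szz ql" "0 \<le> sxx qr" "0 \<le> szz qr"
    using pos by (auto simp: sxx_def szz_def)
  let ?l = "qsharpL ql db" and ?r = "qsharpR qr db"
  have R: "riemann g eta lam ?l ?r"
    using s hsharp_bounds(1)[of ql db] hsharp_bounds(2)[of qr db]
    unfolding qsharpL_def qsharpR_def by unfold_locales (auto intro: wet_recon)
  have n: "0 \<le> W ?l" "0 \<le> W ?r"
    unfolding qsharpL_def qsharpR_def
    by (rule recon_bounds[OF pos(1-3) hsharp_bounds(1) hsharp_bounds(3)[OF pos(1)] W]
        recon_bounds[OF pos(4-6) hsharp_bounds(2) hsharp_bounds(4)[OF pos(4)] W])+
  have W0: "W 0 = 0" using W by auto
  have dry: "W (recon q hs) = 0 \<or> uu (recon q hs) = uu q \<and> 0 < hh (recon q hs)" if "0 \<le> hs" for q hs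
    using that W0 by (cases "hs = 0") (auto simp: recon_sel recon_zero)
  note dry = dry[OF hsharp_bounds(1), of ql ql db, folded qsharpL_def]
    dry[OF hsharp_bounds(2), of qr qr db, folded qsharpR_def]
  have A: "- min 0 (Sig1 g eta lam ?l ?r) \<le> A" "max 0 (Sig3 g eta lam ?l ?r) \<le> A"
    by (auto simp: A_def Amax_def)
  have "W (FL g eta lam ql qr db) \<le> (uu ?l - min 0 (Sig1 g eta lam ?l ?r)) * W ?l"
    unfolding FL_FR_comp[OF R W] by (rule riemann.FwL_le[OF R W])
  also have "\<dots> \<le> (uu ?l + A) * W ?l" using A n by (intro mult_right_mono) auto
  finally show "W (FL g eta lam ql qr db) \<le> (uu ql + A) * W ?l" using dry by auto
  have "(uu ?r - A) * W ?r \<le> (uu ?r - max 0 (Sig3 g eta lam ?l ?r)) * W ?r"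
    using A n by (intro mult_right_mono) auto
  also have "\<dots> \<le> W (FR g eta lam ql qr db)"
    unfolding FL_FR_comp[OF R W] by (rule riemann.FwL_le[OF R W])
  finally show "(uu qr - A) * W ?r \<le> W (FR g eta lam ql qr db)" using dry by auto
  show "W ?l \<noteq> 0 \<Longrightarrow> \<bar>uu ql\<bar> \<le> A" "W ?r \<noteq> 0 \<Longrightarrow> \<bar>uu qr\<bar> \<le> A"
    using riemann.abs_ul_le[OF R] riemann.abs_ur_le[OF R] dry unfolding A_def by metis+
qed

lemma positivity:
  assumes "0 < dt" "\<And>i. 0 < dx i"
    and pos: "\<And>i. 0 \<le> hh (q i)" "\<And>i. 0 \<le> hsxx (q i)" "\<And>i. 0 \<le> hszz (q i)"
    and cfl: "\<And>i. dt * Amax g eta lam (qsharpL (q i) (b (i + 1) - b i)) (qsharpR (q (i + 1)) (b (i + 1) - b i))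
       \<le> min (dx i) (dx (i + 1)) / 2"
    and W: "W \<in> {hh, hsxx, hszz}"
  shows "0 \<le> W (scheme_step g eta lam dt dx b q i)"
proof -
  let ?A = "\<lambda>i. Amax g eta lam (qsharpL (q i) (b (i + 1) - b i)) (qsharpR (q (i + 1)) (b (i + 1) - b i))"
  have step: "W (scheme_step g eta lam dt dx b q i) = W (q i) - dt / dx i *
     (W (FL g eta lam (q i) (q (i + 1)) (b (i + 1) - b i)) - W (FR g eta lam (q (i - 1)) (q i) (b i - b (i - 1))))"
    using W by (auto simp: scheme_step_def st_linear)
  have "dt * ?A i \<le> dx i / 2" by (rule order_trans[OF cfl]) simp
  moreover have "dt * ?A (i - 1) \<le> dx i / 2" by (rule order_trans[OF cfl]) simp
  ultimately have c: "dt / dx i * ?A i \<le> 1 / 2" "dt / dx i * ?A (i - 1) \<le> 1 / 2"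
    using assms(2)[of i] by (auto simp: field_simps)
  have "dt / dx i * (W (FL g eta lam (q i) (q (i + 1)) (b (i + 1) - b i))
      - W (FR g eta lam (q (i - 1)) (q i) (b i - b (i - 1)))) \<le> W (q i)"
  proof (rule half_cells[where A = "?A i" and B = "?A (i - 1)" and u = "uu (q i)"])
    show "0 \<le> W (qsharpL (q i) (b (i + 1) - b i))" "W (qsharpL (q i) (b (i + 1) - b i)) \<le> W (q i)"
      "0 \<le> W (qsharpR (q i) (b i - b (i - 1)))" "W (qsharpR (q i) (b i - b (i - 1))) \<le> W (q i)"
      unfolding qsharpL_def qsharpR_def
      by (rule recon_bounds[OF pos hsharp_bounds(1) hsharp_bounds(3)[OF pos(1)] W]
          recon_bounds[OF pos hsharp_bounds(2) hsharp_bounds(4)[OF pos(1)] W])+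
    show "0 \<le> dt / dx i" using assms(1) assms(2)[of i] by simp
    show "dt / dx i * ?A i \<le> 1 / 2" "dt / dx i * ?A (i - 1) \<le> 1 / 2" by (fact c)+
  qed (use FL_comp_le[OF pos(1-3)[of i] pos(1-3)[of "i + 1"] W]
         FL_comp_le[OF pos(1-3)[of "i - 1"] pos(1-3)[of i] W, of "b i - b (i - 1)"] in simp_all)
  then show ?thesis unfolding step by simp
qed

section \<open>Energy inequality with topography\<close>

text \<open>The potential energy is transported by the mass flux at the interface bottom level
  \<open>max bl br\<close>, the level from which the reconstructed heights are measured.\<close>

definition Gnum :: "st \<Rightarrow> st \<Rightarrow> real \<Rightarrow> real \<Rightarrow> real" where
  "Gnum ql qr bl br = Ghom g eta lam (qsharpL ql (br - bl)) (qsharpR qr (br - bl))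
     + g * max bl br * Fh_hom g eta lam (qsharpL ql (br - bl)) (qsharpR qr (br - bl))"

lemma energy_inequality:
  assumes l: "adm ql" and r: "adm qr"
  shows "Gnum ql qr bl br \<le> Gt g eta lam ql bl
      + gradEt g eta lam ql bl \<bullet> (FL g eta lam ql qr (br - bl) - flux g eta lam ql)"
    and "Gt g eta lam qr br
      + gradEt g eta lam qr br \<bullet> (FR g eta lam ql qr (br - bl) - flux g eta lam qr) \<le> Gnum ql qr bl br"
proof -
  define L where "L = qsharpL ql (br - bl)"
  define R where "R = qsharpR qr (br - bl)"
  define hL where "hL = hsharpL ql (br - bl)"
  define hR where "hR = hsharpR qr (br - bl)"
  define F where "F = Fh_hom g eta lam L R"
  have pos: "0 \<le> hL" "0 \<le> hR" by (simp_all add: hL_def hR_def hsharp_bounds)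
  have L: "L = recon ql hL" and R: "R = recon qr hR"
    by (simp_all add: L_def R_def hL_def hR_def qsharpL_def qsharpR_def)
  have s: "0 < sxx ql" "0 < szz ql" "0 < sxx qr" "0 < szz qr" "0 < hh ql" "0 < hh qr"
    using l r by (auto simp: adm_def)
  have riem: "riemann g eta lam L R"
    unfolding L R using s pos by unfold_locales (auto intro: wet_recon)
  have dl: "L = 0 \<and> hL = 0 \<or> adm L \<and> hL = hh L \<and> uu ql = uu L \<and> sxx ql = sxx L \<and> szz ql = szz L"
    using pos l unfolding L by (cases "hL = 0") (auto simp: recon_zero adm_def recon_sel)
  have dr: "R = 0 \<and> hR = 0 \<or> adm R \<and> hR = hh R \<and> uu qr = uu R \<and> sxx qr = sxx R \<and> szz qr = szz R"
    using pos r unfolding R by (cases "hR = 0") (auto simp: recon_zero adm_def recon_sel)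
  have G: "Gnum ql qr bl br = Ghom g eta lam L R + g * max bl br * F"
    by (simp add: Gnum_def L_def R_def F_def)
  have hF: "hh (FL_hom g eta lam L R) = F" "hh (FR_hom g eta lam L R) = F"
    by (simp_all add: FL_hom_def FR_hom_def F_def st_defs)
  \<comment> \<open>Cell and reconstructed state share velocity and stresses, so their energy
    gradients differ only in the coefficient of \<open>h\<close>; \<open>p\<close> stands for the
    hydrostatic momentum correction.\<close>
  have shift: "tangent h u x z (v + (0, p, 0, 0)) + g * b * hh (v + (0, p, 0, 0))
     = tangent h' u x z v + g * (h + b - h') * hh v + u * p" for h h' u x z v p b
    by (simp add: tangent_def st_defs algebra_simps)
  have hyd: "max bl br * F \<le> (hh ql + bl - hL) * F" "(hh qr + br - hR) * F \<le> max bl br * F"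
  proof -
    have "hL = 0 \<and> hh ql + bl - hL \<le> max bl br \<or> hh ql + bl - hL = max bl br"
      unfolding hL_def hsharpL_def by (auto simp: max_def)
    moreover have "hL = 0 \<Longrightarrow> F \<le> 0"
      unfolding F_def by (rule riemann.Fh_hom_left_vacuum[OF riem]) (simp add: L recon_zero)
    ultimately show "max bl br * F \<le> (hh ql + bl - hL) * F" by (auto intro: mult_right_mono_neg)
    have "hR = 0 \<and> hh qr + br - hR \<le> max bl br \<or> hh qr + br - hR = max bl br"
      unfolding hR_def hsharpR_def by (auto simp: max_def)
    moreover have "hR = 0 \<Longrightarrow> 0 \<le> F"
      unfolding F_def by (rule riemann.Fh_hom_right_vacuum[OF riem]) (simp add: R recon_zero)
    ultimately show "(hh qr + br - hR) * F \<le> max bl br * F" by (auto intro: mult_right_mono)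
  qed
  have hom: "Ghom g eta lam L R
      \<le> tangent hL (uu ql) (sxx ql) (szz ql) (FL_hom g eta lam L R) - g * hL^2 * uu ql / 2"
    "tangent hR (uu qr) (sxx qr) (szz qr) (FR_hom g eta lam L R) - g * hR^2 * uu qr / 2
      \<le> Ghom g eta lam L R"
    by (rule riemann.Ghom_le[OF riem _ _ s(1,2) dl] riemann.Ghom_ge[OF riem _ _ s(3,4) dr];
        use dl dr in blast)+
  have at: "tangent (hh q) (uu q) (sxx q) (szz q) (flux g eta lam q) = GG g eta lam q + g * (hh q)^2 * uu q / 2"
    "hh (flux g eta lam q) = hh q * uu q" if "adm q" for q
    using tangent_at(2) that by (auto simp: adm_def flux_def hh_def[of "(_,_)"] uu_def)
  have "Gt g eta lam ql bl + gradEt g eta lam ql bl \<bullet> (FL g eta lam ql qr (br - bl) - flux g eta lam ql)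
     = tangent (hh ql) (uu ql) (sxx ql) (szz ql) (FL g eta lam ql qr (br - bl))
       + g * bl * hh (FL g eta lam ql qr (br - bl)) - g * (hh ql)^2 * uu ql / 2"
    unfolding inner_gradEt[OF l] tangent_linear Gt_def st_linear at[OF l] by (simp add: algebra_simps)
  \<comment> \<open>The momentum correction times \<open>uu ql\<close> turns
    \<open>g * (hh ql)^2 * uu ql / 2\<close> into the same expression with \<open>hL\<close>, as
    required by the homogeneous inequality.\<close>
  also have "\<dots> = tangent hL (uu ql) (sxx ql) (szz ql) (FL_hom g eta lam L R) - g * hL^2 * uu ql / 2
      + g * ((hh ql + bl - hL) * F)"
    unfolding FL_def L_def[symmetric] R_def[symmetric] hL_def[symmetric] shift[of _ _ _ _ _ _ _ hL] hF
    by (simp add: algebra_simps)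
  also have "\<dots> \<ge> Gnum ql qr bl br"
    unfolding G mult.assoc using hom(1) hyd(1) g_pos by (intro add_mono mult_left_mono) auto
  finally show "Gnum ql qr bl br \<le> Gt g eta lam ql bl
      + gradEt g eta lam ql bl \<bullet> (FL g eta lam ql qr (br - bl) - flux g eta lam ql)" .
  have "Gt g eta lam qr br + gradEt g eta lam qr br \<bullet> (FR g eta lam ql qr (br - bl) - flux g eta lam qr)
     = tangent (hh qr) (uu qr) (sxx qr) (szz qr) (FR g eta lam ql qr (br - bl))
       + g * br * hh (FR g eta lam ql qr (br - bl)) - g * (hh qr)^2 * uu qr / 2"
    unfolding inner_gradEt[OF r] tangent_linear Gt_def st_linear at[OF r] by (simp add: algebra_simps)
  also have "\<dots> = tangent hR (uu qr) (sxx qr) (szz qr) (FR_hom g eta lam L R) - g * hR^2 * uu qr / 2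
      + g * ((hh qr + br - hR) * F)"
    unfolding FR_def L_def[symmetric] R_def[symmetric] hR_def[symmetric] shift[of _ _ _ _ _ _ _ hR] hF
    by (simp add: algebra_simps)
  also have "\<dots> \<le> Gnum ql qr bl br"
    unfolding G mult.assoc using hom(2) hyd(2) g_pos by (intro add_mono mult_left_mono) auto
  finally show "Gt g eta lam qr br + gradEt g eta lam qr br \<bullet> (FR g eta lam ql qr (br - bl) - flux g eta lam qr)
      \<le> Gnum ql qr bl br" .
qed

end

section \<open>Equal states and the steady state at rest\<close>

context riemann
begin

lemma equal_states:
  assumes "qr = ql" "0 < hl"
  shows "qls = ql" "qrs = ql" "us = ul" "ps = Pl"
proof -
  have c: "0 < cl" "cr = cl" using assms cl_pos by (auto simp: cL_def cR_def)
  show us: "us = ul" using c assms by (simp add: ustar_def field_simps)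
  then show "ps = Pl" using cl_jump by simp
  have "hls = hl" "hrs = hl" using assms c by (simp_all add: hLstar_def hRstar_def)
  then show "qls = ql" "qrs = ql"
    using wet_sel[OF wet_l] us assms by (simp_all add: qLstar_def qRstar_def Let_def) (simp_all add: st_defs prod_eq_iff)
qed

lemma hom_consistent:
  assumes "qr = ql" "0 < hl"
  shows "FL_hom g eta lam ql qr = flux g eta lam ql" "FR_hom g eta lam ql qr = flux g eta lam ql"
  using equal_states[OF assms] assms(1) unfolding FL_hom_eq FR_hom_eq by simp_all

lemma EhatL_consistent: "qr = ql \<Longrightarrow> 0 < hl \<Longrightarrow> EhatL g eta lam ql qr = EE g eta lam ql"
  using equal_states qs_sel(1) by (simp add: EhatL_def)

end

context riemann
begin

interpretation m: riemann g eta lam "mir qr" "mir ql" by (rule riemann_mir)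

lemma Ghom_consistent:
  assumes "qr = ql" "0 < hl"
  shows "Ghom g eta lam ql qr = GG g eta lam ql"
proof -
  have "EhatL g eta lam ql qr = EE g eta lam ql" using assms by (rule EhatL_consistent)
  moreover have "EhatR g eta lam ql qr = EE g eta lam qr"
    unfolding EhatR_def using m.EhatL_consistent assms by simp
  ultimately show ?thesis unfolding Ghom_def using assms(1) by simp
qed

end

context viscoelastic
begin

lemma qsharp_flat: "0 < hh q \<Longrightarrow> qsharpL q 0 = q" "0 < hh q \<Longrightarrow> qsharpR q 0 = q"
  by (simp_all add: qsharpL_def qsharpR_def hsharpL_def hsharpR_def recon_self)

lemma flux_consistent:
  assumes "adm q"
  shows "FL g eta lam q q 0 = flux g eta lam q" "FR g eta lam q q 0 = flux g eta lam q"
proof -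
  have h: "0 < hh q" using assms by (simp add: adm_def)
  have R: "riemann g eta lam q q"
    using assms by unfold_locales (auto simp: adm_def wet_def)
  show "FL g eta lam q q 0 = flux g eta lam q" "FR g eta lam q q 0 = flux g eta lam q"
    using riemann.hom_consistent[OF R refl h] h
    by (simp_all add: FL_def FR_def qsharp_flat hsharpL_def hsharpR_def flip: zero_prod_def)
qed

lemma Gnum_consistent:
  assumes "adm q"
  shows "Gnum q q b b = Gt g eta lam q b"
proof -
  have h: "0 < hh q" using assms by (simp add: adm_def)
  have R: "riemann g eta lam q q"
    using assms by unfold_locales (auto simp: adm_def wet_def)
  have "Fh_hom g eta lam q q = hh (FL_hom g eta lam q q)" by (simp add: FL_hom_def st_defs)
  also have "\<dots> = hh q * uu q"
    using riemann.hom_consistent[OF R refl h] h by (simp add: flux_def hh_def[of "(_,_)"] uu_def)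
  finally show ?thesis
    using riemann.Ghom_consistent[OF R refl h] h by (simp add: Gnum_def Gt_def qsharp_flat)
qed

text \<open>A level surface makes both reconstructed heights equal to the smaller height, so the
  solver sees two identical states and returns their exact flux \<open>g * m^2 / 2\<close>, the
  stress part of the pressure being zero. The hydrostatic correction replaces \<open>m\<close> by
  the height of the cell.\<close>

lemma rest_fluxes:
  assumes l: "0 < hh ql" "uu ql = 0" "sxx ql = 1" "szz ql = 1"
    and r: "0 < hh qr" "uu qr = 0" "sxx qr = 1" "szz qr = 1"
    and level: "hh ql + bl = hh qr + br"
  shows "FL g eta lam ql qr (br - bl) = (0, g * (hh ql)^2 / 2, 0, 0)"
    and "FR g eta lam ql qr (br - bl) = (0, g * (hh qr)^2 / 2, 0, 0)"
proof -
  define m where "m = min (hh ql) (hh qr)"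
  have m: "0 < m" using l r by (simp add: m_def)
  have h: "hsharpL ql (br - bl) = m" "hsharpR qr (br - bl) = m"
    using l(1) r(1) level by (auto simp: hsharpL_def hsharpR_def m_def)
  define q where "q = qsharpL ql (br - bl)"
  have q: "q = (m, 0, m, m)" "qsharpR qr (br - bl) = q"
    using l r by (simp_all add: q_def qsharpL_def qsharpR_def h recon_def)
  have prim: "hh q = m" "uu q = 0" "hu q = 0" "hsxx q = m" "hszz q = m" "sxx q = 1" "szz q = 1"
    using m by (simp_all add: q st_defs uu_def sxx_def szz_def)
  have R: "riemann g eta lam q q"
    using m by unfold_locales (simp_all add: wet_def prim)
  have "flux g eta lam q = (0, g * m^2 / 2, 0, 0)"
    by (simp add: flux_def PP_def prim)
  then have hom: "FL_hom g eta lam q q = (0, g * m^2 / 2, 0, 0)" "FR_hom g eta lam q q = (0, g * m^2 / 2, 0, 0)"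
    using riemann.hom_consistent[OF R refl] m prim(1) by simp_all
  show "FL g eta lam ql qr (br - bl) = (0, g * (hh ql)^2 / 2, 0, 0)"
    "FR g eta lam ql qr (br - bl) = (0, g * (hh qr)^2 / 2, 0, 0)"
    unfolding FL_def FR_def q(2) q_def[symmetric] hom h by simp_all
qed

lemma well_balanced:
  assumes "\<And>i. 0 < hh (q i) \<and> uu (q i) = 0 \<and> hh (q i) + b i = C \<and> sxx (q i) = 1 \<and> szz (q i) = 1"
  shows "scheme_step g eta lam dt dx b q i = q i"
proof -
  have "FL g eta lam (q i) (q (i + 1)) (b (i + 1) - b i) = (0, g * (hh (q i))^2 / 2, 0, 0)"
    "FR g eta lam (q (i - 1)) (q i) (b i - b (i - 1)) = (0, g * (hh (q i))^2 / 2, 0, 0)"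
    by (rule rest_fluxes; use assms[of i] assms[of "i + 1"] assms[of "i - 1"] in simp)+
  then show ?thesis by (simp add: scheme_step_def)
qed

lemma conservative: "hh (FL g eta lam ql qr db) = hh (FR g eta lam ql qr db)"
  by (simp add: FL_def FR_def FL_hom_def FR_hom_def st_defs)

end

section \<open>Consistency\<close>

context riemann
begin

text \<open>Freezing \<open>h^2 * sxx\<close> and \<open>szz / h^2\<close> makes each stress jump a
  multiple of \<open>y - 1\<close>, which the mass relation turns into the velocity jump. At
  \<open>y = 1\<close> the coefficients are \<open>2 * hsxx ql\<close> and
  \<open>- 2 * hszz ql\<close>, those of the nonconservative products.\<close>

lemma left_stress_jump:
  assumes "0 < hl"
  defines "y \<equiv> hl / hls"
  shows "cl * (sxx qls - sxx ql) = hsxx ql * (y + 1) * (us - ul)"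
    and "cl * (szz qls - szz ql) = - hszz ql * ((y + 1) / y^2) * (us - ul)"
proof -
  have s: "0 < hls" "0 < cl" using left_ratio(1) cl_pos assms by auto
  have y: "0 < y" using s assms by simp
  have c: "cl * (y - 1) = hl * (us - ul)"
    using left_ratio(2)[OF assms(1)] s by (simp add: y_def)
  have "sxx qls = sxx ql * y^2" "szz qls = szz ql / y^2"
    using s assms by (simp_all add: sxx_def[of qls] szz_def[of qls] qLstar_sel power_divide)
  then have "cl * (sxx qls - sxx ql) = sxx ql * (y + 1) * (cl * (y - 1))"
    and "cl * (szz qls - szz ql) = - szz ql * ((y + 1) / y^2) * (cl * (y - 1))"
    using y by (simp_all add: field_simps power2_eq_square)
  then show "cl * (sxx qls - sxx ql) = hsxx ql * (y + 1) * (us - ul)"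
    "cl * (szz qls - szz ql) = - hszz ql * ((y + 1) / y^2) * (us - ul)"
    unfolding c wet_sel[OF wet_l] by (simp_all add: mult_ac)
qed

text \<open>The gap is the total defect of the stresses in the jump relations. Grouping by states,
  each specific stress is multiplied by the mass flux \<open>cl\<close> or \<open>cr\<close> through
  its outer wave; no mass crosses the contact, so it contributes nothing.\<close>

lemma flux_gap:
  "FwR g eta lam hsxx ql qr - FwL g eta lam hsxx ql qr
     = cl * (sxx qls - sxx ql) + cr * (sxx qrs - sxx qr)"
  "FwR g eta lam hszz ql qr - FwL g eta lam hszz ql qr
     = cl * (szz qls - szz ql) + cr * (szz qrs - szz qr)"
proof -
  have gap: "W qr * ur - W ql * ul - S1 * (W qls - W ql) - S2 * (W qrs - W qls) - S3 * (W qr - W qrs)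
     = cl * (w1 - w0) + cr * (w2 - w3)"
    if "W ql = hl * w0" "W qls = hls * w1" "W qrs = hrs * w2" "W qr = hr * w3" for W :: "st \<Rightarrow> real" and w0 w1 w2 w3
  proof -
    have "W qr * ur - W ql * ul - S1 * (W qls - W ql) - S2 * (W qrs - W qls) - S3 * (W qr - W qrs)
      = hls * (us - S1) * w1 - hl * (ul - S1) * w0 + hrs * (S3 - us) * w2 - hr * (S3 - ur) * w3"
      unfolding that Sig2_def by (simp add: algebra_simps)
    then show ?thesis unfolding left_mass right_mass by (simp add: algebra_simps)
  qed
  have "FwR g eta lam W ql qr - FwL g eta lam W ql qr =
     W qr * ur - W ql * ul - S1 * (W qls - W ql) - S2 * (W qrs - W qls) - S3 * (W qr - W qrs)"
    for W :: "st \<Rightarrow> real"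
    unfolding FwR_def FwL_def min_zero_eq by (simp add: algebra_simps)
  note this[of hsxx] this[of hszz]
  then show "FwR g eta lam hsxx ql qr - FwL g eta lam hsxx ql qr
     = cl * (sxx qls - sxx ql) + cr * (sxx qrs - sxx qr)"
    "FwR g eta lam hszz ql qr - FwL g eta lam hszz ql qr
     = cl * (szz qls - szz ql) + cr * (szz qrs - szz qr)"
    using gap[of hsxx "sxx ql" "sxx qls" "sxx qrs" "sxx qr"] gap[of hszz "szz ql" "szz qls" "szz qrs" "szz qr"]
      wet_sel[OF wet_l] wet_sel[OF wet_r] wet_sel[OF wet_qls] wet_sel[OF wet_qrs]
    unfolding qs_sel by metis+
qed

end

context riemann
begin

interpretation m: riemann g eta lam "mir qr" "mir ql" by (rule riemann_mir)

lemma flux_gap_waves: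
  assumes "0 < hl" "0 < hr"
  defines "y \<equiv> 1 + hl * (us - ul) / cl" and "y' \<equiv> 1 + hr * (ur - us) / cr"
  shows "FwR g eta lam hsxx ql qr - FwL g eta lam hsxx ql qr
     = hsxx ql * (y + 1) * (us - ul) + hsxx qr * (y' + 1) * (ur - us)"
  and "FwR g eta lam hszz ql qr - FwL g eta lam hszz ql qr
     = - hszz ql * ((y + 1) / y^2) * (us - ul) + - hszz qr * ((y' + 1) / y'^2) * (ur - us)"
  using left_stress_jump[OF assms(1)] m.left_stress_jump assms(2)
  unfolding flux_gap y_def y'_def left_ratio(2)[OF assms(1), symmetric] right_ratio(2)[OF assms(2), symmetric]
  by (simp_all add: mir_star qLstar_mir)

end

section \<open>Landau estimates as the two states merge and the topography jump vanishes\<close>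

lemma norm_st_le:
  "\<bar>hh v\<bar> \<le> norm v" "\<bar>hu v\<bar> \<le> norm v" "\<bar>hsxx v\<bar> \<le> norm v" "\<bar>hszz v\<bar> \<le> norm v"
  "norm v \<le> \<bar>hh v\<bar> + \<bar>hu v\<bar> + \<bar>hsxx v\<bar> + \<bar>hszz v\<bar>"
proof -
  obtain a b c d where v: "v = (a, b, c, d)" by (cases v) auto
  have le: "norm a \<le> norm (a, b, c, d)" "norm (b, c, d) \<le> norm (a, b, c, d)"
    "norm b \<le> norm (b, c, d)" "norm (c, d) \<le> norm (b, c, d)" "norm c \<le> norm (c, d)" "norm d \<le> norm (c, d)"
    using norm_fst_le[of a "(b, c, d)"] norm_snd_le[of "(b, c, d)" a] norm_fst_le[of b "(c, d)"]
      norm_snd_le[of "(c, d)" b] norm_fst_le[of c d] norm_snd_le[of d c] by auto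
  then show "\<bar>hh v\<bar> \<le> norm v" "\<bar>hu v\<bar> \<le> norm v" "\<bar>hsxx v\<bar> \<le> norm v" "\<bar>hszz v\<bar> \<le> norm v"
    unfolding v st_defs by auto
  show "norm v \<le> \<bar>hh v\<bar> + \<bar>hu v\<bar> + \<bar>hsxx v\<bar> + \<bar>hszz v\<bar>"
    using norm_Pair_le[of a "(b, c, d)"] norm_Pair_le[of b "(c, d)"] norm_Pair_le[of c d]
    unfolding v st_defs by auto
qed

lemma null_times_bigo:
  fixes f h :: "'a \<Rightarrow> real"
  assumes "(f \<longlongrightarrow> 0) F" "h \<in> O[F](N)"
  shows "(\<lambda>t. f t * h t) \<in> o[F](N)"
proof -
  have "f \<in> o[F](\<lambda>_. 1)" using assms(1) by (intro smalloI_tendsto) auto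
  from landau_o.small_big_mult[OF this assms(2)] show ?thesis by simp
qed

lemma convergent_times_bigo:
  fixes f h :: "'a \<Rightarrow> real"
  assumes "(f \<longlongrightarrow> c) F" "h \<in> O[F](N)"
  shows "(\<lambda>t. f t * h t) \<in> O[F](N)"
proof -
  have "f \<in> O[F](\<lambda>_. 1)" using assms(1) by (intro bigoI_tendsto[of _ _ c]) auto
  from landau_o.big_mult[OF this assms(2)] show ?thesis by simp
qed

lemma tendsto_st:
  assumes "(f \<longlongrightarrow> q) F"
  shows "((\<lambda>t. hh (f t)) \<longlongrightarrow> hh q) F" "((\<lambda>t. hu (f t)) \<longlongrightarrow> hu q) F"
    "((\<lambda>t. hsxx (f t)) \<longlongrightarrow> hsxx q) F" "((\<lambda>t. hszz (f t)) \<longlongrightarrow> hszz q) F"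
  using assms unfolding st_defs by (auto intro!: tendsto_intros)

text \<open>Rephrases the epsilon-delta condition of \<open>consistent_fluxes\<close> along a
  filter, so that it becomes a statement about terms of order \<open>o(N)\<close>.\<close>

locale vanishing_jump = viscoelastic +
  fixes F :: "'a filter" and ql qr :: "'a \<Rightarrow> st" and db :: "'a \<Rightarrow> real" and q :: st
  assumes adm_q: "adm q" and lim_l: "(ql \<longlongrightarrow> q) F" and lim_r: "(qr \<longlongrightarrow> q) F" and lim_b: "(db \<longlongrightarrow> 0) F"
begin

definition N :: "'a \<Rightarrow> real" where "N t = norm (qr t - ql t) + \<bar>db t\<bar>"
definition L :: "'a \<Rightarrow> st" where "L t = qsharpL (ql t) (db t)"
definition R :: "'a \<Rightarrow> st" where "R t = qsharpR (qr t) (db t)"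

abbreviation "cl t \<equiv> cL g eta lam (L t) (R t)"
abbreviation "cr t \<equiv> cR g eta lam (L t) (R t)"
abbreviation "us t \<equiv> ustar g eta lam (L t) (R t)"
abbreviation "du t \<equiv> (hu (qr t - ql t) - uu q * hh (qr t - ql t)) / hh q"

lemma q_pos: "0 < hh q" "0 < sxx q" "0 < szz q"
  using adm_q by (auto simp: adm_def)

lemma jumps_bigo:
  "(\<lambda>t. hh (qr t) - hh (ql t)) \<in> O[F](N)" "(\<lambda>t. hu (qr t) - hu (ql t)) \<in> O[F](N)"
  "(\<lambda>t. hsxx (qr t) - hsxx (ql t)) \<in> O[F](N)" "(\<lambda>t. hszz (qr t) - hszz (ql t)) \<in> O[F](N)"
  "(\<lambda>t. max 0 (db t)) \<in> O[F](N)" "(\<lambda>t. max 0 (- db t)) \<in> O[F](N)"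
  "(\<lambda>t. hh (R t) - hh (L t)) \<in> O[F](N)"
proof -
  have *: "f \<in> O[F](N)" if "\<And>t. \<bar>f t\<bar> \<le> N t" for f :: "'a \<Rightarrow> real"
    by (rule bigoI[of _ 1]) (use that in \<open>auto simp: abs_le_iff intro!: always_eventually order_trans[OF _ abs_ge_self]\<close>)
  have st: "\<bar>hh (qr t) - hh (ql t)\<bar> \<le> norm (qr t - ql t)" "\<bar>hu (qr t) - hu (ql t)\<bar> \<le> norm (qr t - ql t)"
    "\<bar>hsxx (qr t) - hsxx (ql t)\<bar> \<le> norm (qr t - ql t)" "\<bar>hszz (qr t) - hszz (ql t)\<bar> \<le> norm (qr t - ql t)" for t
    using norm_st_le(1-4)[of "qr t - ql t"] by (simp_all add: st_linear)
  have db: "\<bar>db t\<bar> \<le> N t" for t by (simp add: N_def)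
  have N: "norm (qr t - ql t) \<le> N t" for t by (simp add: N_def)
  show "(\<lambda>t. hh (qr t) - hh (ql t)) \<in> O[F](N)" "(\<lambda>t. hu (qr t) - hu (ql t)) \<in> O[F](N)"
    "(\<lambda>t. hsxx (qr t) - hsxx (ql t)) \<in> O[F](N)" "(\<lambda>t. hszz (qr t) - hszz (ql t)) \<in> O[F](N)"
    by (rule *, rule order_trans[OF st(1) N] order_trans[OF st(2) N]
        order_trans[OF st(3) N] order_trans[OF st(4) N])+
  show "(\<lambda>t. max 0 (db t)) \<in> O[F](N)" "(\<lambda>t. max 0 (- db t)) \<in> O[F](N)"
    by (rule *, rule order_trans[OF _ db], simp add: max_def)+
  have "\<bar>hh (R t) - hh (L t)\<bar> \<le> \<bar>hh (qr t) - hh (ql t)\<bar> + \<bar>db t\<bar>" for t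
    unfolding R_def L_def qsharpR_def qsharpL_def hh_recon hsharpL_def hsharpR_def by (auto simp: max_def)
  then show "(\<lambda>t. hh (R t) - hh (L t)) \<in> O[F](N)"
    using st(1) by (intro *) (metis N_def add_right_mono order_trans)
qed

lemma lim_prim:
  assumes "(f \<longlongrightarrow> q) F"
  shows "((\<lambda>t. uu (f t)) \<longlongrightarrow> uu q) F" "((\<lambda>t. sxx (f t)) \<longlongrightarrow> sxx q) F" "((\<lambda>t. szz (f t)) \<longlongrightarrow> szz q) F"
  using tendsto_st[OF assms] q_pos(1) unfolding uu_def sxx_def szz_def by (auto intro!: tendsto_divide)

lemma ev_pos: "(f \<longlongrightarrow> q) F \<Longrightarrow> \<forall>\<^sub>F t in F. adm (f t)"
  using order_tendstoD(1)[OF tendsto_st(1) q_pos(1)] order_tendstoD(1)[OF lim_prim(2) q_pos(2)]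
    order_tendstoD(1)[OF lim_prim(3) q_pos(3)]
  unfolding adm_def by (auto intro!: eventually_conj)

lemma lim_h: "((\<lambda>t. hh (L t)) \<longlongrightarrow> hh q) F" "((\<lambda>t. hh (R t)) \<longlongrightarrow> hh q) F"
proof -
  have "((\<lambda>t. max 0 (hh (ql t) - max 0 (db t))) \<longlongrightarrow> max 0 (hh q - max 0 0)) F"
    "((\<lambda>t. max 0 (hh (qr t) - max 0 (- db t))) \<longlongrightarrow> max 0 (hh q - max 0 (- 0))) F"
    by (intro tendsto_intros tendsto_st lim_l lim_r lim_b)+
  then show "((\<lambda>t. hh (L t)) \<longlongrightarrow> hh q) F" "((\<lambda>t. hh (R t)) \<longlongrightarrow> hh q) F"
    using q_pos unfolding L_def R_def qsharpL_def qsharpR_def hh_recon hsharpL_def hsharpR_def by simp_all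
qed

lemma ev_regular: "\<forall>\<^sub>F t in F. adm (ql t) \<and> adm (qr t) \<and> 0 < hh (L t) \<and> 0 < hh (R t)
    \<and> uu (L t) = uu (ql t) \<and> sxx (L t) = sxx (ql t) \<and> szz (L t) = szz (ql t)
    \<and> uu (R t) = uu (qr t) \<and> sxx (R t) = sxx (qr t) \<and> szz (R t) = szz (qr t)
    \<and> hh (L t) = hh (ql t) - max 0 (db t) \<and> hh (R t) = hh (qr t) - max 0 (- db t)
    \<and> riemann g eta lam (L t) (R t)"
  using order_tendstoD(1)[OF lim_h(1) q_pos(1)] order_tendstoD(1)[OF lim_h(2) q_pos(1)]
    ev_pos[OF lim_l] ev_pos[OF lim_r]
proof eventually_elim
  case (elim t)
  have h: "0 < hsharpL (ql t) (db t)" "0 < hsharpR (qr t) (db t)"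
    using elim unfolding L_def R_def qsharpL_def qsharpR_def hh_recon by auto
  have a: "adm (L t)" "adm (R t)"
    using elim h by (auto simp: adm_def L_def R_def qsharpL_def qsharpR_def recon_sel)
  then have "riemann g eta lam (L t) (R t)"
    by unfold_locales (auto simp: adm_def wet_def)
  moreover have "hh (L t) = hh (ql t) - max 0 (db t)" "hh (R t) = hh (qr t) - max 0 (- db t)"
    using h unfolding L_def R_def qsharpL_def qsharpR_def hh_recon hsharpL_def hsharpR_def
    by (auto simp: max_def split: if_splits)
  ultimately show ?case
    using elim h by (simp add: L_def R_def qsharpL_def qsharpR_def recon_sel)
qed

lemma lim_sharp_prim:
  "((\<lambda>t. uu (L t)) \<longlongrightarrow> uu q) F" "((\<lambda>t. uu (R t)) \<longlongrightarrow> uu q) F"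
  "((\<lambda>t. sxx (L t)) \<longlongrightarrow> sxx q) F" "((\<lambda>t. sxx (R t)) \<longlongrightarrow> sxx q) F"
  "((\<lambda>t. szz (L t)) \<longlongrightarrow> szz q) F" "((\<lambda>t. szz (R t)) \<longlongrightarrow> szz q) F"
  by (rule Lim_transform_eventually[OF lim_prim(1)[OF lim_l]] Lim_transform_eventually[OF lim_prim(1)[OF lim_r]]
      Lim_transform_eventually[OF lim_prim(2)[OF lim_l]] Lim_transform_eventually[OF lim_prim(2)[OF lim_r]]
      Lim_transform_eventually[OF lim_prim(3)[OF lim_l]] Lim_transform_eventually[OF lim_prim(3)[OF lim_r]],
      rule eventually_mono[OF ev_regular], simp)+

lemma lim_speeds:
  defines "c \<equiv> hh q * aa g eta lam q"
  shows "0 < c" "(cl \<longlongrightarrow> c) F" "(cr \<longlongrightarrow> c) F" "(us \<longlongrightarrow> uu q) F"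
proof -
  have w: "wet q" using q_pos by (simp add: wet_def)
  show c: "0 < c" unfolding c_def using q_pos aa_pos[OF w] by simp
  have a: "((\<lambda>t. aa g eta lam (L t)) \<longlongrightarrow> aa g eta lam q) F" "((\<lambda>t. aa g eta lam (R t)) \<longlongrightarrow> aa g eta lam q) F"
    unfolding aa_def dPdh_def by (intro tendsto_intros lim_sharp_prim lim_h)+
  have P: "((\<lambda>t. PP g eta lam (L t)) \<longlongrightarrow> PP g eta lam q) F" "((\<lambda>t. PP g eta lam (R t)) \<longlongrightarrow> PP g eta lam q) F"
    unfolding PP_def k_fold by (intro tendsto_intros lim_sharp_prim lim_h; simp)+
  have n: "hh q * aa g eta lam q + hh q * aa g eta lam q \<noteq> 0" using c unfolding c_def by linarith
  have "(cl \<longlongrightarrow> hh q * (aa g eta lam q + 2 * (max 0 (uu q - uu q)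
      + max 0 (PP g eta lam q - PP g eta lam q) / (hh q * aa g eta lam q + hh q * aa g eta lam q)))) F"
    unfolding cL_def by (intro tendsto_intros lim_sharp_prim lim_h a P n)
  then show cl: "(cl \<longlongrightarrow> c) F" by (simp add: c_def)
  have "(cr \<longlongrightarrow> hh q * (aa g eta lam q + 2 * (max 0 (uu q - uu q)
      + max 0 (PP g eta lam q - PP g eta lam q) / (hh q * aa g eta lam q + hh q * aa g eta lam q)))) F"
    unfolding cR_def by (intro tendsto_intros lim_sharp_prim lim_h a P n)
  then show cr: "(cr \<longlongrightarrow> c) F" by (simp add: c_def)
  have "(us \<longlongrightarrow> (c * uu q + c * uu q + PP g eta lam q - PP g eta lam q) / (c + c)) F"
    unfolding ustar_def using c by (intro tendsto_intros lim_sharp_prim P cl cr) simp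
  then show "(us \<longlongrightarrow> uu q) F" using c by (simp add: field_simps)
qed

lemma quotient_jump_bigo:
  fixes f :: "st \<Rightarrow> real"
  assumes "(\<lambda>t. f (qr t) - f (ql t)) \<in> O[F](N)" "((\<lambda>t. f (ql t)) \<longlongrightarrow> f q) F"
  shows "(\<lambda>t. f (qr t) / hh (qr t) - f (ql t) / hh (ql t)) \<in> O[F](N)"
proof -
  have "((\<lambda>t. 1 / hh (qr t)) \<longlongrightarrow> 1 / hh q) F"
    "((\<lambda>t. f (ql t) / (hh (ql t) * hh (qr t))) \<longlongrightarrow> f q / (hh q * hh q)) F"
    by (intro tendsto_intros assms(2) tendsto_st lim_l lim_r; use q_pos in simp)+
  then have "(\<lambda>t. (1 / hh (qr t)) * (f (qr t) - f (ql t))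
      - (f (ql t) / (hh (ql t) * hh (qr t))) * (hh (qr t) - hh (ql t))) \<in> O[F](N)"
    by (intro sum_in_bigo convergent_times_bigo[OF _ assms(1)] convergent_times_bigo[OF _ jumps_bigo(1)])
  also have "?this \<longleftrightarrow> ?thesis"
    by (rule landau_o.big.in_cong, rule eventually_mono[OF ev_regular]) (auto simp: adm_def field_simps)
  finally show ?thesis .
qed

lemma sharp_jumps_bigo:
  "(\<lambda>t. uu (R t) - uu (L t)) \<in> O[F](N)" "(\<lambda>t. sxx (R t) - sxx (L t)) \<in> O[F](N)"
  "(\<lambda>t. szz (R t) - szz (L t)) \<in> O[F](N)" "(\<lambda>t. PP g eta lam (R t) - PP g eta lam (L t)) \<in> O[F](N)"
proof -
  have "(\<lambda>t. uu (qr t) - uu (ql t)) \<in> O[F](N)" "(\<lambda>t. sxx (qr t) - sxx (ql t)) \<in> O[F](N)"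
    "(\<lambda>t. szz (qr t) - szz (ql t)) \<in> O[F](N)"
    unfolding uu_def sxx_def szz_def using quotient_jump_bigo jumps_bigo tendsto_st[OF lim_l] by auto
  moreover have "(\<lambda>t. uu (qr t) - uu (ql t)) \<in> O[F](N) \<longleftrightarrow> (\<lambda>t. uu (R t) - uu (L t)) \<in> O[F](N)"
    "(\<lambda>t. sxx (qr t) - sxx (ql t)) \<in> O[F](N) \<longleftrightarrow> (\<lambda>t. sxx (R t) - sxx (L t)) \<in> O[F](N)"
    "(\<lambda>t. szz (qr t) - szz (ql t)) \<in> O[F](N) \<longleftrightarrow> (\<lambda>t. szz (R t) - szz (L t)) \<in> O[F](N)"
    by (rule landau_o.big.in_cong, rule eventually_mono[OF ev_regular], simp)+
  ultimately show b: "(\<lambda>t. uu (R t) - uu (L t)) \<in> O[F](N)" "(\<lambda>t. sxx (R t) - sxx (L t)) \<in> O[F](N)"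
    "(\<lambda>t. szz (R t) - szz (L t)) \<in> O[F](N)" by auto
  have "((\<lambda>t. g / 2 * (hh (R t) + hh (L t)) + 2 * k * (szz (R t) - sxx (R t)))
      \<longlongrightarrow> g / 2 * (hh q + hh q) + 2 * k * (szz q - sxx q)) F"
    "((\<lambda>t. 2 * k * hh (L t)) \<longlongrightarrow> 2 * k * hh q) F"
    by (intro tendsto_intros lim_h lim_sharp_prim)+
  then have "(\<lambda>t. (g / 2 * (hh (R t) + hh (L t)) + 2 * k * (szz (R t) - sxx (R t))) * (hh (R t) - hh (L t))
     + (2 * k * hh (L t)) * (szz (R t) - szz (L t)) - (2 * k * hh (L t)) * (sxx (R t) - sxx (L t))) \<in> O[F](N)"
    by (intro sum_in_bigo convergent_times_bigo[OF _ jumps_bigo(7)] convergent_times_bigo[OF _ b(2)]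
        convergent_times_bigo[OF _ b(3)])
  moreover have "PP g eta lam (R t) - PP g eta lam (L t)
     = (g / 2 * (hh (R t) + hh (L t)) + 2 * k * (szz (R t) - sxx (R t))) * (hh (R t) - hh (L t))
     + (2 * k * hh (L t)) * (szz (R t) - szz (L t)) - (2 * k * hh (L t)) * (sxx (R t) - sxx (L t))" for t
    unfolding PP_def k_fold by (simp add: field_simps power2_eq_square)
  ultimately show "(\<lambda>t. PP g eta lam (R t) - PP g eta lam (L t)) \<in> O[F](N)" by (simp only:)
qed

lemma wave_jumps_bigo:
  "(\<lambda>t. us t - uu (L t)) \<in> O[F](N)" "(\<lambda>t. uu (R t) - us t) \<in> O[F](N)"
proof -
  note lim = lim_speeds(2,3)
  have n: "hh q * aa g eta lam q + hh q * aa g eta lam q \<noteq> 0" using lim_speeds(1) by linarith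
  have "((\<lambda>t. cr t / (cl t + cr t)) \<longlongrightarrow> hh q * aa g eta lam q / (hh q * aa g eta lam q + hh q * aa g eta lam q)) F"
    "((\<lambda>t. 1 / (cl t + cr t)) \<longlongrightarrow> 1 / (hh q * aa g eta lam q + hh q * aa g eta lam q)) F"
    by (intro tendsto_intros lim n)+
  then have "(\<lambda>t. (cr t / (cl t + cr t)) * (uu (R t) - uu (L t))
      - (1 / (cl t + cr t)) * (PP g eta lam (R t) - PP g eta lam (L t))) \<in> O[F](N)"
    by (intro sum_in_bigo convergent_times_bigo[OF _ sharp_jumps_bigo(1)] convergent_times_bigo[OF _ sharp_jumps_bigo(4)])
  also have "?this \<longleftrightarrow> (\<lambda>t. us t - uu (L t)) \<in> O[F](N)"
  proof (rule landau_o.big.in_cong, rule eventually_mono[OF ev_regular])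
    fix t assume "adm (ql t) \<and> adm (qr t) \<and> 0 < hh (L t) \<and> 0 < hh (R t)
      \<and> uu (L t) = uu (ql t) \<and> sxx (L t) = sxx (ql t) \<and> szz (L t) = szz (ql t)
      \<and> uu (R t) = uu (qr t) \<and> sxx (R t) = sxx (qr t) \<and> szz (R t) = szz (qr t)
      \<and> hh (L t) = hh (ql t) - max 0 (db t) \<and> hh (R t) = hh (qr t) - max 0 (- db t)
      \<and> riemann g eta lam (L t) (R t)"
    then have "us t - uu (L t) = (cr t * (uu (R t) - uu (L t)) + PP g eta lam (L t) - PP g eta lam (R t)) / (cl t + cr t)"
      using riemann.us_minus_ul by blast
    then show "(cr t / (cl t + cr t)) * (uu (R t) - uu (L t))
      - (1 / (cl t + cr t)) * (PP g eta lam (R t) - PP g eta lam (L t)) = us t - uu (L t)"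
      by (simp add: add_divide_distrib diff_divide_distrib algebra_simps)
  qed
  finally show l: "(\<lambda>t. us t - uu (L t)) \<in> O[F](N)" .
  show "(\<lambda>t. uu (R t) - us t) \<in> O[F](N)"
    using sum_in_bigo(2)[OF sharp_jumps_bigo(1) l] by simp
qed

text \<open>Near \<open>q\<close> reconstruction leaves the velocities unchanged, so this is the
  linearization of \<open>hu / h\<close> at \<open>q\<close>: the remainder is a sum of jumps of
  order \<open>N\<close> with coefficients tending to 0.\<close>

lemma velocity_jump_linearized: "(\<lambda>t. uu (R t) - uu (L t) - du t) \<in> o[F](N)"
proof -
  have "(\<lambda>t. (1 / hh (qr t) - 1 / hh q) * (hu (qr t) - hu (ql t))
      - (uu (ql t) / hh (qr t) - uu q / hh q) * (hh (qr t) - hh (ql t))) \<in> o[F](N)"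
    by (intro sum_in_smallo null_times_bigo[OF _ jumps_bigo(2)] null_times_bigo[OF _ jumps_bigo(1)]
        LIM_zero tendsto_intros tendsto_st lim_prim lim_l lim_r) (use q_pos in simp_all)
  also have "?this \<longleftrightarrow> ?thesis"
    by (rule landau_o.small.in_cong, rule eventually_mono[OF ev_regular])
       (use q_pos in \<open>auto simp: adm_def st_linear uu_def[of "ql _"] uu_def[of "qr _"] field_simps\<close>)
  finally show ?thesis .
qed

text \<open>How the velocity jump is shared between the two outer waves depends on the speeds, but
  the shares add up to the whole. Coefficients with a common limit therefore see only the total jump
  at first order.\<close>

lemma waves_linearized:
  assumes "(A \<longlongrightarrow> m) F" "(B \<longlongrightarrow> m) F"
  shows "(\<lambda>t. A t * (us t - uu (L t)) + B t * (uu (R t) - us t) - m * du t) \<in> o[F](N)"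
proof -
  have scale: "(\<lambda>t. m * (uu (R t) - uu (L t) - du t)) \<in> o[F](N)"
    using velocity_jump_linearized by (cases "m = 0") auto
  have "(\<lambda>t. (A t - m) * (us t - uu (L t)) + (B t - m) * (uu (R t) - us t)
      + m * (uu (R t) - uu (L t) - du t)) \<in> o[F](N)"
    using assms by (intro sum_in_smallo null_times_bigo[OF _ wave_jumps_bigo(1)]
        null_times_bigo[OF _ wave_jumps_bigo(2)] LIM_zero scale)
  then show ?thesis by (simp add: algebra_simps)
qed

definition gap :: "'a \<Rightarrow> st" where
  "gap t = FR g eta lam (ql t) (qr t) (db t) - FL g eta lam (ql t) (qr t) (db t)
     + ncterm g q (qr t - ql t) (db t)"

lemma gap_sel:
  "hh (gap t) = 0"
  "hu (gap t) = g / 2 * ((hh (qr t))^2 - (hh (R t))^2 - (hh (ql t))^2 + (hh (L t))^2) + g * hh q * db t"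
  "hsxx (gap t) = FwR g eta lam hsxx (L t) (R t) - FwL g eta lam hsxx (L t) (R t) - 2 * hsxx q * du t"
  "hszz (gap t) = FwR g eta lam hszz (L t) (R t) - FwL g eta lam hszz (L t) (R t) + 2 * hszz q * du t"
proof -
  have "hsharpL (ql t) (db t) = hh (L t)" "hsharpR (qr t) (db t) = hh (R t)"
    by (simp_all add: L_def R_def qsharpL_def qsharpR_def hh_recon)
  then have "gap t = (0, g / 2 * ((hh (qr t))^2 - (hh (R t))^2 - (hh (ql t))^2 + (hh (L t))^2) + g * hh q * db t,
     FwR g eta lam hsxx (L t) (R t) - FwL g eta lam hsxx (L t) (R t) - 2 * hsxx q * du t,
     FwR g eta lam hszz (L t) (R t) - FwL g eta lam hszz (L t) (R t) + 2 * hszz q * du t)"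
    unfolding gap_def FR_def FL_def FR_hom_def FL_hom_def ncterm_def Let_def L_def[symmetric] R_def[symmetric]
    by (simp add: algebra_simps add_divide_distrib diff_divide_distrib)
  then show "hh (gap t) = 0"
    "hu (gap t) = g / 2 * ((hh (qr t))^2 - (hh (R t))^2 - (hh (ql t))^2 + (hh (L t))^2) + g * hh q * db t"
    "hsxx (gap t) = FwR g eta lam hsxx (L t) (R t) - FwL g eta lam hsxx (L t) (R t) - 2 * hsxx q * du t"
    "hszz (gap t) = FwR g eta lam hszz (L t) (R t) - FwL g eta lam hszz (L t) (R t) + 2 * hszz q * du t"
    by (simp_all add: hh_def[of "(_,_)"] hu_def[of "(_,_)"] hsxx_def[of "(_,_)"] hszz_def[of "(_,_)"])
qed

text \<open>Differences of squares turn the hydrostatic corrections into sums of heights times the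
  positive parts of \<open>- db\<close> and \<open>db\<close>. Splitting the \<open>db\<close> of
  the source term likewise, every coefficient tends to 0.\<close>

lemma gap_momentum: "(\<lambda>t. hu (gap t)) \<in> o[F](N)"
proof -
  have "(\<lambda>t. (g / 2 * (hh (qr t) + hh (R t) - 2 * hh q)) * max 0 (- db t)
      - (g / 2 * (hh (ql t) + hh (L t) - 2 * hh q)) * max 0 (db t)) \<in> o[F](N)"
  proof (intro sum_in_smallo null_times_bigo jumps_bigo)
    have "((\<lambda>t. g / 2 * (hh (qr t) + hh (R t) - 2 * hh q)) \<longlongrightarrow> g / 2 * (hh q + hh q - 2 * hh q)) F"
      "((\<lambda>t. g / 2 * (hh (ql t) + hh (L t) - 2 * hh q)) \<longlongrightarrow> g / 2 * (hh q + hh q - 2 * hh q)) F"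
      by (intro tendsto_intros tendsto_st lim_l lim_r lim_h)+
    then show "((\<lambda>t. g / 2 * (hh (qr t) + hh (R t) - 2 * hh q)) \<longlongrightarrow> 0) F"
      "((\<lambda>t. g / 2 * (hh (ql t) + hh (L t) - 2 * hh q)) \<longlongrightarrow> 0) F" by simp_all
  qed
  also have "?this \<longleftrightarrow> ?thesis"
  proof (rule landau_o.small.in_cong, rule eventually_mono[OF ev_regular], elim conjE)
    fix t assume h: "hh (L t) = hh (ql t) - max 0 (db t)" "hh (R t) = hh (qr t) - max 0 (- db t)"
    have b: "db t = max 0 (db t) - max 0 (- db t)" by auto
    show "(g / 2 * (hh (qr t) + hh (R t) - 2 * hh q)) * max 0 (- db t)
      - (g / 2 * (hh (ql t) + hh (L t) - 2 * hh q)) * max 0 (db t) = hu (gap t)"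
      unfolding gap_sel h by (subst (5) b) (simp add: field_simps power2_eq_square)
  qed
  finally show ?thesis .
qed

text \<open>The ratios \<open>y\<close> and \<open>y'\<close> tend to 1, so \<open>y + 1\<close> and
  \<open>(y + 1) / y^2\<close> tend to 2, the factor of the nonconservative terms in the stress
  equations.\<close>

lemma gap_stress: "(\<lambda>t. hsxx (gap t)) \<in> o[F](N)" "(\<lambda>t. hszz (gap t)) \<in> o[F](N)"
proof -
  define y where "y t = 1 + hh (L t) * (us t - uu (L t)) / cl t" for t
  define y' where "y' t = 1 + hh (R t) * (uu (R t) - us t) / cr t" for t
  have n: "hh q * aa g eta lam q \<noteq> 0" using lim_speeds(1) by linarith
  have "(y \<longlongrightarrow> 1 + hh q * (uu q - uu q) / (hh q * aa g eta lam q)) F"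
    "(y' \<longlongrightarrow> 1 + hh q * (uu q - uu q) / (hh q * aa g eta lam q)) F"
    unfolding y_def y'_def by (intro tendsto_intros lim_h lim_sharp_prim lim_speeds n)+
  then have y: "(y \<longlongrightarrow> 1) F" "(y' \<longlongrightarrow> 1) F" by simp_all
  have wq: "wet q" using q_pos by (simp add: wet_def)
  have w: "((\<lambda>t. hh (L t) * sxx (L t) * (y t + 1)) \<longlongrightarrow> hsxx q * (1 + 1)) F"
    "((\<lambda>t. hh (R t) * sxx (R t) * (y' t + 1)) \<longlongrightarrow> hsxx q * (1 + 1)) F"
    "((\<lambda>t. - (hh (L t) * szz (L t)) * ((y t + 1) / (y t)^2)) \<longlongrightarrow> - hszz q * ((1 + 1) / 1^2)) F"
    "((\<lambda>t. - (hh (R t) * szz (R t)) * ((y' t + 1) / (y' t)^2)) \<longlongrightarrow> - hszz q * ((1 + 1) / 1^2)) F"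
    unfolding wet_sel[OF wq] by (intro tendsto_intros lim_h lim_sharp_prim y; simp)+
  have ev: "\<forall>\<^sub>F t in F. hh (L t) * sxx (L t) * (y t + 1) * (us t - uu (L t))
        + hh (R t) * sxx (R t) * (y' t + 1) * (uu (R t) - us t) - hsxx q * (1 + 1) * du t = hsxx (gap t)
      \<and> - (hh (L t) * szz (L t)) * ((y t + 1) / (y t)^2) * (us t - uu (L t))
        + - (hh (R t) * szz (R t)) * ((y' t + 1) / (y' t)^2) * (uu (R t) - us t)
        - (- hszz q * ((1 + 1) / 1^2)) * du t = hszz (gap t)"
  proof (rule eventually_mono[OF ev_regular], elim conjE)
    fix t assume h: "0 < hh (L t)" "0 < hh (R t)" and r: "riemann g eta lam (L t) (R t)"
    have c: "hsxx (L t) = hh (L t) * sxx (L t)" "hszz (L t) = hh (L t) * szz (L t)"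
      "hsxx (R t) = hh (R t) * sxx (R t)" "hszz (R t) = hh (R t) * szz (R t)"
      using h by (simp_all add: sxx_def szz_def)
    show "hh (L t) * sxx (L t) * (y t + 1) * (us t - uu (L t))
        + hh (R t) * sxx (R t) * (y' t + 1) * (uu (R t) - us t) - hsxx q * (1 + 1) * du t = hsxx (gap t)
      \<and> - (hh (L t) * szz (L t)) * ((y t + 1) / (y t)^2) * (us t - uu (L t))
        + - (hh (R t) * szz (R t)) * ((y' t + 1) / (y' t)^2) * (uu (R t) - us t)
        - (- hszz q * ((1 + 1) / 1^2)) * du t = hszz (gap t)"
      unfolding gap_sel riemann.flux_gap_waves[OF r h, folded y_def y'_def, unfolded c] by simp
  qed
  have "(\<lambda>t. hh (L t) * sxx (L t) * (y t + 1) * (us t - uu (L t))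
        + hh (R t) * sxx (R t) * (y' t + 1) * (uu (R t) - us t) - hsxx q * (1 + 1) * du t) \<in> o[F](N)"
    by (rule waves_linearized[OF w(1,2)])
  also have "?this \<longleftrightarrow> (\<lambda>t. hsxx (gap t)) \<in> o[F](N)"
    by (rule landau_o.small.in_cong, rule eventually_mono[OF ev], elim conjE)
  finally show "(\<lambda>t. hsxx (gap t)) \<in> o[F](N)" .
  have "(\<lambda>t. - (hh (L t) * szz (L t)) * ((y t + 1) / (y t)^2) * (us t - uu (L t))
        + - (hh (R t) * szz (R t)) * ((y' t + 1) / (y' t)^2) * (uu (R t) - us t)
        - (- hszz q * ((1 + 1) / 1^2)) * du t) \<in> o[F](N)"
    by (rule waves_linearized[OF w(3,4)])
  also have "?this \<longleftrightarrow> (\<lambda>t. hszz (gap t)) \<in> o[F](N)"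
    by (rule landau_o.small.in_cong, rule eventually_mono[OF ev], elim conjE)
  finally show "(\<lambda>t. hszz (gap t)) \<in> o[F](N)" .
qed

lemma gap_small:
  assumes "0 < e"
  shows "\<forall>\<^sub>F t in F. norm (gap t) \<le> e * N t"
proof -
  \<comment> \<open>One third for each component of the gap other than \<open>h\<close>, where it
    vanishes.\<close>
  have "0 < e / 3" using assms by simp
  note s = landau_o.smallD[OF gap_momentum this] landau_o.smallD[OF gap_stress(1) this]
    landau_o.smallD[OF gap_stress(2) this]
  show ?thesis using s
  proof eventually_elim
    case (elim t)
    have "norm (N t) = N t" by (simp add: N_def)
    then show ?case using elim norm_st_le(5)[of "gap t"] by (simp add: gap_sel(1))
  qed
qed

end

lemma (in viscoelastic) consistent: "consistent_fluxes g eta lam (FL g eta lam) (FR g eta lam)"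
  unfolding consistent_fluxes_def
proof (intro conjI allI impI)
  fix q assume a: "adm q"
  show "FL g eta lam q q 0 = flux g eta lam q" "FR g eta lam q q 0 = flux g eta lam q"
    by (rule flux_consistent[OF a])+
next
  fix q :: st and e :: real assume a: "adm q" and e: "0 < e"
  \<comment> \<open>Neighbourhoods of \<open>(q, q, 0)\<close> let both states and the topography
    jump vary independently.\<close>
  let ?F = "nhds (q, q, 0 :: real)"
  interpret vanishing_jump g eta lam ?F fst "\<lambda>p. fst (snd p)" "\<lambda>p. snd (snd p)" q
    using a by unfold_locales (auto intro!: tendsto_eq_intros filterlim_ident)
  obtain d where d: "0 < d" "\<And>p. dist p (q, q, 0) < d \<Longrightarrow> norm (gap p) \<le> e * N p"
    using gap_small[OF e] unfolding eventually_nhds_metric by blast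
  show "\<exists>d>0. \<forall>ql qr db. norm (ql - q) < d \<and> norm (qr - q) < d \<and> \<bar>db\<bar> < d \<longrightarrow>
      norm (FR g eta lam ql qr db - FL g eta lam ql qr db + ncterm g q (qr - ql) db)
        \<le> e * (norm (qr - ql) + \<bar>db\<bar>)"
  proof (intro exI[of _ "d / 3"] conjI allI impI)
    fix ql qr db assume n: "norm (ql - q) < d / 3 \<and> norm (qr - q) < d / 3 \<and> \<bar>db\<bar> < d / 3"
    have "dist (ql, qr, db) (q, q, 0) \<le> norm (ql - q) + (norm (qr - q) + norm db)"
      unfolding dist_norm using norm_Pair_le[of "ql - q" "(qr - q, db)"] norm_Pair_le[of "qr - q" db] by simp
    then have "norm (gap (ql, qr, db)) \<le> e * N (ql, qr, db)" using n by (intro d(2)) simp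
    then show "norm (FR g eta lam ql qr db - FL g eta lam ql qr db + ncterm g q (qr - ql) db)
        \<le> e * (norm (qr - ql) + \<bar>db\<bar>)"
      by (simp add: gap_def N_def)
  qed (use d in simp)
qed

section \<open>The five properties of the scheme with topography\<close>

theorem theorem2:
  fixes g eta lam :: real
  assumes g_pos: "0 < g" and eta_pos: "0 < eta" and lam_pos: "0 < lam"
  shows
    \<comment> \<open>(i) consistency\<close>
    "consistent_fluxes g eta lam (FL g eta lam) (FR g eta lam)
     \<comment> \<open>(ii) positivity under the CFL condition at every interface\<close>
     \<and> (\<forall>dt dx b q. 0 < dt \<and> (\<forall>i. 0 < dx i)
          \<and> (\<forall>i. 0 \<le> hh (q i) \<and> 0 \<le> hsxx (q i) \<and> 0 \<le> hszz (q i))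
          \<and> (\<forall>i::int. dt * Amax g eta lam (qsharpL (q i) (b (i + 1) - b i))
                                          (qsharpR (q (i + 1)) (b (i + 1) - b i))
                       \<le> min (dx i) (dx (i + 1)) / 2)
        \<longrightarrow> (\<forall>i. 0 \<le> hh (scheme_step g eta lam dt dx b q i)
                 \<and> 0 \<le> hsxx (scheme_step g eta lam dt dx b q i)
                 \<and> 0 \<le> hszz (scheme_step g eta lam dt dx b q i)))
     \<comment> \<open>(iii) conservativity in h\<close>
     \<and> (\<forall>ql qr db. hh (FL g eta lam ql qr db) = hh (FR g eta lam ql qr db))
     \<comment> \<open>(iv) semi-discrete energy inequality\<close>
     \<and> (\<exists>Gnum :: st \<Rightarrow> st \<Rightarrow> real \<Rightarrow> real \<Rightarrow> real.
          (\<forall>q b. adm q \<longrightarrow> Gnum q q b b = Gt g eta lam q b)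
          \<and> (\<forall>ql qr bl br. adm ql \<and> adm qr \<longrightarrow>
               Gt g eta lam qr br + gradEt g eta lam qr br
                   \<bullet> (FR g eta lam ql qr (br - bl) - flux g eta lam qr)
                 \<le> Gnum ql qr bl br
               \<and> Gnum ql qr bl br
                 \<le> Gt g eta lam ql bl + gradEt g eta lam ql bl
                   \<bullet> (FL g eta lam ql qr (br - bl) - flux g eta lam ql)))
     \<comment> \<open>(v) well-balancedness: steady states at rest are preserved\<close>
     \<and> (\<forall>dt dx b q C. 0 < dt \<and> (\<forall>i. 0 < dx i)
          \<and> (\<forall>i. 0 < hh (q i) \<and> uu (q i) = 0 \<and> hh (q i) + b i = C
                 \<and> sxx (q i) = 1 \<and> szz (q i) = 1)
        \<longrightarrow> (\<forall>i. scheme_step g eta lam dt dx b q i = q i))"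
proof -
  interpret viscoelastic g eta lam using assms by unfold_locales
  show ?thesis
  proof (intro conjI allI impI)
    show "consistent_fluxes g eta lam (FL g eta lam) (FR g eta lam)" by (rule consistent)
  next
    fix dt :: real and dx b q i
    assume A: "0 < dt \<and> (\<forall>i. 0 < dx i)
          \<and> (\<forall>i. 0 \<le> hh (q i) \<and> 0 \<le> hsxx (q i) \<and> 0 \<le> hszz (q i))
          \<and> (\<forall>i::int. dt * Amax g eta lam (qsharpL (q i) (b (i + 1) - b i))
                                          (qsharpR (q (i + 1)) (b (i + 1) - b i))
                       \<le> min (dx i) (dx (i + 1)) / 2)"
    have "0 \<le> W (scheme_step g eta lam dt dx b q i)" if "W \<in> {hh, hsxx, hszz}" for W
      by (rule positivity[OF _ _ _ _ _ _ that]; use A in blast)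
    then show "0 \<le> hh (scheme_step g eta lam dt dx b q i)" "0 \<le> hsxx (scheme_step g eta lam dt dx b q i)"
      "0 \<le> hszz (scheme_step g eta lam dt dx b q i)" by auto
  next
    fix ql qr db show "hh (FL g eta lam ql qr db) = hh (FR g eta lam ql qr db)" by (rule conservative)
  next
    show "\<exists>Gnum :: st \<Rightarrow> st \<Rightarrow> real \<Rightarrow> real \<Rightarrow> real.
          (\<forall>q b. adm q \<longrightarrow> Gnum q q b b = Gt g eta lam q b)
          \<and> (\<forall>ql qr bl br. adm ql \<and> adm qr \<longrightarrow>
               Gt g eta lam qr br + gradEt g eta lam qr br
                   \<bullet> (FR g eta lam ql qr (br - bl) - flux g eta lam qr)
                 \<le> Gnum ql qr bl br
               \<and> Gnum ql qr bl br
                 \<le> Gt g eta lam ql bl + gradEt g eta lam ql bl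
                   \<bullet> (FL g eta lam ql qr (br - bl) - flux g eta lam ql))"
      using Gnum_consistent energy_inequality by blast
  next
    fix dt C :: real and dx b :: "int \<Rightarrow> real" and q i
    assume "0 < dt \<and> (\<forall>i. 0 < dx i)
          \<and> (\<forall>i. 0 < hh (q i) \<and> uu (q i) = 0 \<and> hh (q i) + b i = C
                 \<and> sxx (q i) = 1 \<and> szz (q i) = 1)"
    then show "scheme_step g eta lam dt dx b q i = q i"
      by (intro well_balanced) blast
  qed
qed

end
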